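(* Let $\Omega\subset\mathbb{C}$ be a bounded simply connected domain with a piecewise smooth boundary. Then $$\sqrt{\rho(\Omega)}\;\leq\;\lambda_{A^{2}}(\Omega)\;\leq\;\frac{\mathrm{Area}(\Omega)}{\sqrt{2\pi}},$$ where $\rho(\Omega)$ is the torsional rigidity of $\Omega$ and $\lambda_{A^2}(\Omega)=\inf_{f\in A^{2}(\Omega)}\|\overline{z}-f\|_{2}$.
   Context: $A^{2}(\Omega)$ is the Bergman space of functions $f$ analytic in $\Omega$ with $\int_\Omega |f|^2\,dA<\infty$, where $dA$ is area measure, and $\|\cdot\|_2$ is the norm of $L^2(\Omega,dA)$. The torsional rigidity is defined through the stress function $u$, the solution of $\Delta u=-2$ in $\Omega$, $u|_{\partial\Omega}=0$, by $$\sqrt{\rho(\Omega)}=\frac{2\left|\int_\Omega u\,dA\right|}{\|\nabla u\|_{L^2(\Omega)}},$$ equivalently $\rho(\Omega)=2\int_\Omega u\,dA=\int_\Omega|\nabla u|^2\,dA$. *)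

theory Defs
  imports "HOL-Complex_Analysis.Complex_Analysis"
begin

text \<open>Area measure is \<^term>\<open>lborel :: complex measure\<close>.\<close>

definition L2_norm_on :: "complex set \<Rightarrow> (complex \<Rightarrow> complex) \<Rightarrow> real" where
  "L2_norm_on \<Omega> g = sqrt (LINT z:\<Omega>|lborel. (cmod (g z))\<^sup>2)"

definition bergman_space :: "complex set \<Rightarrow> (complex \<Rightarrow> complex) set" where
  "bergman_space \<Omega> =
     {f. f holomorphic_on \<Omega> \<and> set_integrable lborel \<Omega> (\<lambda>z. (cmod (f z))\<^sup>2)}"

definition bergman_dist :: "complex set \<Rightarrow> real" where
  "bergman_dist \<Omega> = (INF f\<in>bergman_space \<Omega>. L2_norm_on \<Omega> (\<lambda>z. cnj z - f z))"

text \<open>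
  Real partial derivatives in the directions of \<^term>\<open>Basis :: complex set\<close>, which
  consists of \<^term>\<open>1 :: complex\<close> and \<^term>\<open>\<i>\<close>. They are used on open sets only.
\<close>

definition partial_deriv :: "complex \<Rightarrow> (complex \<Rightarrow> real) \<Rightarrow> complex \<Rightarrow> real" where
  "partial_deriv b u z = frechet_derivative u (at z) b"

definition C2_on :: "complex set \<Rightarrow> (complex \<Rightarrow> real) \<Rightarrow> bool" where
  "C2_on \<Omega> u \<longleftrightarrow> u differentiable_on \<Omega> \<and>
     (\<forall>b\<in>Basis. partial_deriv b u differentiable_on \<Omega> \<and>
        (\<forall>c\<in>Basis. continuous_on \<Omega> (partial_deriv c (partial_deriv b u))))"

definition gradient :: "(complex \<Rightarrow> real) \<Rightarrow> complex \<Rightarrow> complex" where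
  "gradient u z = (\<Sum>b\<in>Basis. partial_deriv b u z *\<^sub>R b)"

definition laplacian :: "(complex \<Rightarrow> real) \<Rightarrow> complex \<Rightarrow> real" where
  "laplacian u z = (\<Sum>b\<in>Basis. partial_deriv b (partial_deriv b u) z)"

definition is_stress_function :: "complex set \<Rightarrow> (complex \<Rightarrow> real) \<Rightarrow> bool" where
  "is_stress_function \<Omega> u \<longleftrightarrow>
     continuous_on (closure \<Omega>) u \<and> C2_on \<Omega> u \<and>
     (\<forall>z\<in>\<Omega>. laplacian u z = - 2) \<and> (\<forall>z\<in>frontier \<Omega>. u z = 0)"

text \<open>
  The boundary value problem determines a solution on the closure of a bounded open set
  uniquely, but not its irrelevant values elsewhere; hence a choice instead of a definite
  description.
\<close>

definition stress_function :: "complex set \<Rightarrow> complex \<Rightarrow> real" where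
  "stress_function \<Omega> = (SOME u. is_stress_function \<Omega> u)"

definition torsional_rigidity :: "complex set \<Rightarrow> real" where
  "torsional_rigidity \<Omega> =
     (let u = stress_function \<Omega>
      in (2 * \<bar>LINT z:\<Omega>|lborel. u z\<bar> / L2_norm_on \<Omega> (gradient u))\<^sup>2)"

text \<open>
  The boundary is traced by a closed piecewise continuously differentiable curve. The curve
  need not be simple, so that, besides piecewise smooth Jordan domains, slit domains are
  covered (their slits are traversed twice).
\<close>

definition piecewise_smooth_boundary :: "complex set \<Rightarrow> bool" where
  "piecewise_smooth_boundary \<Omega> \<longleftrightarrow>
     (\<exists>\<gamma>. valid_path \<gamma> \<and> pathfinish \<gamma> = pathstart \<gamma> \<and> path_image \<gamma> = frontier \<Omega>)"

end

theory Submission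
  imports Defs
begin

text \<open>
  Let \<phi>(w) = \<Sum>n. a(n) w^n be a Riemann map from the unit disc onto \<Omega>.  Comparing areas gives
  \<pi> E \<le> Area(\<Omega>) for E = \<Sum>n. n |a(n)|^2 (\<open>area_bound\<close>).

  The lower bound is an integration by parts.  Read the gradient of the stress function u as a
  complex number, that is, as twice the derivative of u with respect to cnj z.  For f in the
  Bergman space, the derivative of cnj z - f with respect to cnj z is 1 and u vanishes on the
  boundary, so that the integral of (cnj z - f) \<nabla>u equals that of -2u, and Cauchy-Schwarz
  yields 2 |\<integral> u| \<le> \<parallel>cnj z - f\<parallel> \<parallel>\<nabla>u\<parallel>.  Nothing is known about f and \<nabla>u near the
  boundary; therefore u is first replaced by \<eta>(u), where \<eta> is close to the identity and vanishes
  near 0, which makes the integrand compactly supported (\<open>torsion_pairing_bound\<close>).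

  The torsional rigidity refers to a chosen stress function, so one has to exist.  On the disc,
  2 (u \<circ> \<phi>) must be the harmonic extension of the boundary values of |\<phi>|^2 minus |\<phi>|^2.
  The extension is 2 Re G - c(0), where G(w) = \<Sum>k. c(k) w^k and c(k) = \<Sum>m. cnj (a m) a(m+k).
  Since a(k) = B(k) - w B(k+1) for B(k) = \<Sum>j. a(k+j) w^j, a telescoping sum gives

    2 Re G(w) - c(0) - |\<phi>(w)|^2 = (1 - |w|^2) (\<Sum>k. |B(k+1)|^2).

  The right-hand side is nonnegative and, by Cauchy-Schwarz, at most E.  Splitting off a
  polynomial part of \<phi> improves the second bound to decay at the circle
  (\<open>potential_vanishes_at_circle\<close>).  Since \<phi> is proper, this is the boundary condition
  (\<open>exists_stress_function\<close>).

  For the upper bound, the function F = (G \<circ> inverse of \<phi>)' competes.  Transplanted to the disc,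
  cnj z - F becomes the defect cnj \<phi> \<phi>' - G'.  It is the double sum of the terms
  cnj (a m) a(n) e(m,n), where e(m,n) is n cnj w^m w^(n-1) minus its projection to the analytic
  functions.  The scalar product of e(m,n) and e(m',n') is \<pi> min (n n') (m m') / (n + m') if
  n + m' = n' + m, and 0 otherwise.  After exchanging the roles of n and m', the quadratic form
  has the kernel min (n, m', n', m) / 2 on the antidiagonal n + m' = n' + m, and since

    (\<Sum>r\<le>p+q. min (p, q, r, p+q-r)) = p q,

  Schur's test with constant weights gives the bound (\<pi>/2) E^2 \<le> Area(\<Omega>)^2 / (2 \<pi>) for the
  square norm of the defect (\<open>antidiagonal_form_bound\<close>, \<open>bergman_competitor\<close>).
\<close>

section \<open>Conformal change of variables\<close>

lemma scaleR_complex_of_real: "x *\<^sub>R complex_of_real y = complex_of_real (x *\<^sub>R y)"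
  by (simp add: scaleR_conv_of_real)

text \<open>
  Real coordinates of the plane and their inverse, in which a conformal map has a Jacobian matrix.
\<close>

definition cplane :: "real^2 \<Rightarrow> complex" where "cplane v = Complex (v$1) (v$2)"
definition rplane :: "complex \<Rightarrow> real^2" where "rplane z = vector [Re z, Im z]"

lemma rplane_nth [simp]: "rplane z $ 1 = Re z" "rplane z $ 2 = Im z"
  by (simp_all add: rplane_def)

lemma cplane_rplane [simp]: "cplane (rplane z) = z" and rplane_cplane [simp]: "rplane (cplane v) = v"
  by (auto simp: cplane_def vec_eq_iff forall_2)

lemma bounded_linear_cplane: "bounded_linear cplane"
  by (rule linear_conv_bounded_linear[THEN iffD1], rule linearI) (auto simp: cplane_def complex_eq_iff)

lemma bounded_linear_rplane: "bounded_linear rplane"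
  by (rule linear_conv_bounded_linear[THEN iffD1], rule linearI) (auto simp: vec_eq_iff forall_2)

lemma continuous_cplane: "continuous_on A cplane"
  and continuous_rplane: "continuous_on B rplane"
  using bounded_linear_cplane bounded_linear_rplane bounded_linear.linear linear_continuous_on by blast+

text \<open>
  Both coordinate systems have the same boxes with the same volumes, and boxes determine
  Lebesgue measure.
\<close>

lemma distr_cplane: "distr lborel borel cplane = lborel"
proof (rule lborel_eqI[symmetric])
  fix l u :: complex
  assume lu: "\<And>b. b \<in> Basis \<Longrightarrow> l \<bullet> b \<le> u \<bullet> b"
  have m: "cplane \<in> measurable lborel borel"
    using borel_measurable_continuous_onI[OF continuous_cplane] by simp
  have le: "rplane l $ i \<le> rplane u $ i" for i
    using lu[of 1] lu[of \<i>] exhaust_2[of i] by (auto simp: Basis_complex_def)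
  have "cplane -` box l u = box (rplane l) (rplane u)"
    by (auto simp: box_def Basis_complex_def Basis_vec_def cplane_def inner_axis forall_2)
  moreover have "emeasure lborel (box (rplane l) (rplane u)) = (\<Prod>b\<in>Basis. (rplane u - rplane l) \<bullet> b)"
    by (intro emeasure_lborel_box) 
       (auto simp: Basis_vec_def inner_axis le)
  moreover have "(\<Prod>b\<in>(Basis::(real^2) set). (rplane u - rplane l) \<bullet> b) = (\<Prod>b\<in>Basis. (u - l) \<bullet> b)"
  proof -
    have B: "(Basis::(real^2) set) = {axis 1 1, axis 2 1}"
      by (auto simp: Basis_vec_def) (metis (full_types) exhaust_2)
    have ne: "axis 1 1 \<noteq> (axis 2 1 :: real^2)" by (simp add: axis_eq_axis)
    show ?thesis unfolding B using ne by (simp add: Basis_complex_def inner_axis)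
  qed
  ultimately show "emeasure (distr lborel borel cplane) (box l u) = (\<Prod>b\<in>Basis. (u - l) \<bullet> b)"
    by (subst emeasure_distr[OF m]) auto
qed simp

lemma set_integral_cplane:
  fixes f :: "complex \<Rightarrow> complex"
  assumes "set_borel_measurable borel A f"
  shows "set_integrable lborel A f \<longleftrightarrow> set_integrable lborel (cplane -` A) (f \<circ> cplane)"
    and "(LINT z:A|lborel. f z) = (LINT v:cplane -` A|lborel. f (cplane v))"
proof -
  have m: "cplane \<in> measurable lborel borel"
    using borel_measurable_continuous_onI[OF continuous_cplane] by simp
  have i: "indicator (cplane -` A) v = (indicator A (cplane v) :: real)" for v
    by (simp add: indicator_def)
  have mf: "(\<lambda>z. indicator A z *\<^sub>R f z) \<in> borel_measurable borel"
    using assms by (simp add: set_borel_measurable_def)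
  show "set_integrable lborel A f \<longleftrightarrow> set_integrable lborel (cplane -` A) (f \<circ> cplane)"
    unfolding set_integrable_def i o_def
    by (subst distr_cplane[symmetric], subst integrable_distr_eq[OF m mf]) simp
  show "(LINT z:A|lborel. f z) = (LINT v:cplane -` A|lborel. f (cplane v))"
    unfolding set_lebesgue_integral_def i
    by (subst distr_cplane[symmetric], subst integral_distr[OF m mf]) simp
qed

lemma set_integral_lebesgue_iff:
  fixes f :: "'a::euclidean_space \<Rightarrow> 'b::euclidean_space"
  assumes "set_borel_measurable borel A f"
  shows "set_integrable lborel A f \<longleftrightarrow> f absolutely_integrable_on A"
    and "set_integrable lborel A f \<Longrightarrow> (LINT z:A|lborel. f z) = integral A f"
proof -
  have mf: "(\<lambda>z. indicator A z *\<^sub>R f z) \<in> borel_measurable lborel"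
    using assms by (simp add: set_borel_measurable_def)
  show 1: "set_integrable lborel A f \<longleftrightarrow> f absolutely_integrable_on A"
    unfolding set_integrable_def using integrable_completion[OF mf] by simp
  assume "set_integrable lborel A f"
  then have "f absolutely_integrable_on A" using 1 by simp
  then have "integral A f = (LINT z:A|lebesgue. f z)"
    by (simp add: set_lebesgue_integral_eq_integral)
  also have "\<dots> = (LINT z:A|lborel. f z)"
    unfolding set_lebesgue_integral_def using integral_completion[OF mf] by simp
  finally show "(LINT z:A|lborel. f z) = integral A f" by simp
qed

lemma set_borel_measurable_continuous_open:
  fixes f :: "'a::topological_space \<Rightarrow> 'b::real_normed_vector"
  assumes "continuous_on A f" "open A"
  shows "set_borel_measurable borel A f"
  unfolding set_borel_measurable_def
  using assms by (intro borel_measurable_continuous_on_indicator) auto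

text \<open>
  In real coordinates the derivative of g at w is multiplication by g'(w), a scaled rotation whose
  determinant is |g'(w)|^2.
\<close>

lemma conformal_change_of_variables:
  fixes f :: "complex \<Rightarrow> complex"
  assumes "open S" and hol: "g holomorphic_on S" and inj: "inj_on g S"
    and cont: "continuous_on (g ` S) f"
  shows "set_integrable lborel (g ` S) f \<longleftrightarrow>
           set_integrable lborel S (\<lambda>w. (cmod (deriv g w))\<^sup>2 *\<^sub>R f (g w))" (is ?int)
    and "(LINT z:g ` S|lborel. f z) = (LINT w:S|lborel. (cmod (deriv g w))\<^sup>2 *\<^sub>R f (g w))" (is ?eq)
proof -
  let ?F = "\<lambda>w. (cmod (deriv g w))\<^sup>2 *\<^sub>R f (g w)"
  let ?g = "rplane \<circ> g \<circ> cplane" and ?f = "rplane \<circ> f \<circ> cplane"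
  let ?S = "cplane -` S"
  let ?D = "\<lambda>v. (rplane \<circ> (\<lambda>h. deriv g (cplane v) * h) \<circ> cplane)"
  have opg: "open (g ` S)" using open_mapping_thm3[OF hol \<open>open S\<close> inj] .
  have contF: "continuous_on S ?F"
    using hol \<open>open S\<close> holomorphic_on_imp_continuous_on holomorphic_deriv[OF hol \<open>open S\<close>]
    by (intro continuous_intros continuous_on_compose2[OF cont]) auto
  have opS: "open ?S" using \<open>open S\<close> continuous_cplane by (simp add: open_vimage)
  have img: "?g ` ?S = cplane -` (g ` S)"
  proof (intro equalityI subsetI)
    fix v assume "v \<in> cplane -` (g ` S)"
    then obtain w where "w \<in> S" "cplane v = g w" by auto
    then have "v = ?g (rplane w)" "rplane w \<in> ?S"
      by (auto simp flip: \<open>cplane v = g w\<close>)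
    then show "v \<in> ?g ` ?S" by blast
  qed auto
  have bg: "set_borel_measurable borel (g ` S) f" and bS: "set_borel_measurable borel S ?F"
    using set_borel_measurable_continuous_open cont opg contF \<open>open S\<close> by blast+
  have opg': "open (?g ` ?S)" unfolding img using opg continuous_cplane by (simp add: open_vimage)
  have bg': "set_borel_measurable borel (?g ` ?S) ?f"
    unfolding img using opg continuous_cplane
    by (intro set_borel_measurable_continuous_open continuous_on_compose continuous_cplane 
         continuous_on_subset[OF cont] continuous_on_subset[OF continuous_rplane])
       (auto simp: open_vimage)
  have bS': "set_borel_measurable borel ?S (rplane \<circ> ?F \<circ> cplane)"
    by (intro set_borel_measurable_continuous_open opS continuous_on_compose continuous_cplane 
         continuous_on_subset[OF contF] continuous_on_subset[OF continuous_rplane]) auto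
  have der: "(?g has_derivative ?D v) (at v within ?S)" if "v \<in> ?S" for v
  proof -
    have "(g has_field_derivative deriv g (cplane v)) (at (cplane v))"
      using that hol \<open>open S\<close> by (auto intro: holomorphic_derivI)
    then have "(g has_derivative (\<lambda>h. deriv g (cplane v) * h)) (at (cplane v))"
      by (simp add: has_field_derivative_def)
    then have "(?g has_derivative ?D v) (at v)"
      by (intro diff_chain_at bounded_linear_imp_has_derivative bounded_linear_cplane) 
         (simp_all add: bounded_linear_imp_has_derivative bounded_linear_rplane)
    then show ?thesis by (rule has_derivative_at_withinI)
  qed
  have dt: "\<bar>det (matrix (?D v))\<bar> = (cmod (deriv g (cplane v)))\<^sup>2" for v
    unfolding cmod_power2 by (simp add: det_2 matrix_def power2_eq_square cplane_def axis_def)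
  have Fe: "(\<lambda>v. \<bar>det (matrix (?D v))\<bar> *\<^sub>R ?f (?g v)) = rplane \<circ> ?F \<circ> cplane"
    unfolding dt using bounded_linear.linear[OF bounded_linear_rplane] 
    by (auto simp: linear_scale o_def)
  have injg: "inj_on ?g ?S"
    using inj by (auto simp: inj_on_def) (metis cplane_rplane rplane_cplane)
  have main: "rplane \<circ> ?F \<circ> cplane absolutely_integrable_on ?S \<and> integral ?S (rplane \<circ> ?F \<circ> cplane) = b
     \<longleftrightarrow> ?f absolutely_integrable_on (?g ` ?S) \<and> integral (?g ` ?S) ?f = b" for b
    using has_absolute_integral_change_of_variables[OF _ der injg, of ?f b] opS 
    unfolding Fe by simp
  have rc: "set_integrable lborel A (rplane \<circ> h) \<longleftrightarrow> set_integrable lborel A h" 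
     "set_integrable lborel A h \<Longrightarrow> (LINT v:A|lborel. (rplane \<circ> h) v) = rplane (LINT v:A|lborel. h v)"
    for h :: "real^2 \<Rightarrow> complex" and A
  proof -
    have e: "indicat_real A x *\<^sub>R (rplane \<circ> h) x = rplane (indicat_real A x *\<^sub>R h x)" for x
      using bounded_linear.linear[OF bounded_linear_rplane] by (simp add: linear_scale)
    show "set_integrable lborel A (rplane \<circ> h) \<longleftrightarrow> set_integrable lborel A h"
    proof
      assume "set_integrable lborel A h"
      then show "set_integrable lborel A (rplane \<circ> h)"
        unfolding set_integrable_def e using integrable_bounded_linear[OF bounded_linear_rplane] by blast
    next
      assume "set_integrable lborel A (rplane \<circ> h)"
      then show "set_integrable lborel A h"
        unfolding set_integrable_def e 
        using integrable_bounded_linear[OF bounded_linear_cplane, of lborel "\<lambda>x. rplane (indicat_real A x *\<^sub>R h x)"] by simp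
    qed
    show "set_integrable lborel A h \<Longrightarrow> (LINT v:A|lborel. (rplane \<circ> h) v) = rplane (LINT v:A|lborel. h v)"
      unfolding set_integrable_def set_lebesgue_integral_def e
      by (rule integral_bounded_linear[OF bounded_linear_rplane])
  qed
  have 1: "set_integrable lborel (g ` S) f \<longleftrightarrow> ?f absolutely_integrable_on (?g ` ?S)"
    using set_integral_cplane[OF bg] set_integral_lebesgue_iff(1)[OF bg'] rc(1)[of _ "f \<circ> cplane"]
    unfolding img by (simp add: o_assoc)
  have 2: "set_integrable lborel S ?F \<longleftrightarrow> (rplane \<circ> ?F \<circ> cplane) absolutely_integrable_on ?S"
    using set_integral_cplane[OF bS] set_integral_lebesgue_iff(1)[OF bS'] rc(1)[of _ "?F \<circ> cplane"]
    by (simp add: o_assoc)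
  show int: ?int using 1 2 main by blast
  show ?eq
  proof (cases "set_integrable lborel (g ` S) f")
    case True
    have "rplane (LINT z:g ` S|lborel. f z) = integral (?g ` ?S) ?f"
      using set_integral_cplane[OF bg] set_integral_lebesgue_iff[OF bg'] rc[of _ "f \<circ> cplane"] True
      unfolding img by (simp add: o_assoc)
    also have "\<dots> = integral ?S (rplane \<circ> ?F \<circ> cplane)"
      using main 1 2 True int by metis
    also have "\<dots> = rplane (LINT w:S|lborel. ?F w)"
      using set_integral_cplane[OF bS] set_integral_lebesgue_iff[OF bS'] rc[of _ "?F \<circ> cplane"] True int
      by (simp add: o_assoc)
    finally show ?thesis by (metis cplane_rplane)
  next
    case False
    then show ?thesis using int 
      by (simp add: set_integrable_def set_lebesgue_integral_def not_integrable_integral_eq)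
  qed
qed

lemma conformal_change_of_variables_real:
  fixes f :: "complex \<Rightarrow> real"
  assumes "open S" "g holomorphic_on S" "inj_on g S" "continuous_on (g ` S) f"
  shows "set_integrable lborel (g ` S) f \<longleftrightarrow>
           set_integrable lborel S (\<lambda>w. (cmod (deriv g w))\<^sup>2 * f (g w))"
    and "(LINT z:g ` S|lborel. f z) = (LINT w:S|lborel. (cmod (deriv g w))\<^sup>2 * f (g w))"
proof -
  have c: "continuous_on (g ` S) (\<lambda>z. complex_of_real (f z))"
    using assms(4) by (rule continuous_on_of_real)
  note cv = conformal_change_of_variables[OF assms(1-3) c]
  show "set_integrable lborel (g ` S) f \<longleftrightarrow> set_integrable lborel S (\<lambda>w. (cmod (deriv g w))\<^sup>2 * f (g w))"
    using cv(1) unfolding set_integrable_def scaleR_complex_of_real complex_of_real_integrable_eq by (simp only: real_scaleR_def)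
  show "(LINT z:g ` S|lborel. f z) = (LINT w:S|lborel. (cmod (deriv g w))\<^sup>2 * f (g w))"
    using cv(2) unfolding set_lebesgue_integral_def scaleR_complex_of_real integral_complex_of_real of_real_eq_iff by (simp only: real_scaleR_def)
qed

section \<open>Moments and coefficients on the disc\<close>

lemma set_integrable_bounded_continuous:
  fixes f :: "'a::euclidean_space \<Rightarrow> 'b::{banach, second_countable_topology}"
  assumes "open S" "bounded S" "continuous_on S f" "\<And>x. x \<in> S \<Longrightarrow> norm (f x) \<le> B"
  shows "set_integrable lborel S f"
proof -
  have "emeasure lborel S < \<infinity>" using emeasure_bounded_finite[OF assms(2)] by simp
  then have i: "set_integrable lborel S (\<lambda>x. B)"
    using assms(1) unfolding set_integrable_def by (intro integrable_scaleR_left integrable_real_indicator) auto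
  show ?thesis
    using set_borel_measurable_continuous_open[OF assms(3,1)] assms(4)
    unfolding set_integrable_def set_borel_measurable_def
    by (intro Bochner_Integration.integrable_bound[OF i[unfolded set_integrable_def]])
       (auto simp: indicator_def intro: order_trans[OF _ abs_ge_self])
qed

text \<open>
  Write |w|^(2k) as the integral of 2k t^(2k-1) over 0 < t \<le> |w| and exchange the order of
  integration: what remains is the area \<pi> (r^2 - t^2) of an annulus.
\<close>

lemma disc_moment_diag:
  fixes r :: real
  assumes "r \<ge> 0"
  shows "(\<integral>\<^sup>+w\<in>ball 0 r. ennreal (cmod w ^ (2*k)) \<partial>lborel) = ennreal (pi * r^(2*k+2) / (k+1))"
proof (cases "k = 0")
  case True
  then show ?thesis using assms
    by (simp add: emeasure_ball unit_ball_vol_2 power2_eq_square nn_integral_indicator)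
next
  case False
  define d where "d t = real (2*k) * t^(2*k-1)" for t :: real
  have d0: "d t \<ge> 0" if "t \<ge> 0" for t using that by (simp add: d_def)
  have d: "((\<lambda>t. t^(2*k)) has_real_derivative d t) (at t within X)" for t X
    unfolding d_def by (auto intro!: derivative_eq_intros)
  have dm [measurable]: "d \<in> borel_measurable borel" unfolding d_def by measurable
  have 1: "indicator (ball 0 r) w * ennreal (cmod w ^ (2*k)) 
      = (\<integral>\<^sup>+t. (indicator {0<..} t * indicator {0..<r} (cmod w) * indicator {..cmod w} t) * ennreal (d t) \<partial>lborel)" for w :: complex
  proof -
    have "(\<integral>\<^sup>+t. ennreal (d t) * indicator {0..cmod w} t \<partial>lborel) = ennreal (cmod w^(2*k) - 0^(2*k))"
      by (rule nn_integral_FTC_Icc) (use d0 d in auto)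
    moreover have "AE t in lborel. (indicator {0<..} t * indicator {0..<r} (cmod w) * indicator {..cmod w} t) * ennreal (d t)
          = indicator (ball 0 r) w * (ennreal (d t) * indicator {0..cmod w} t)"
      using AE_lborel_singleton[of "0::real"] by eventually_elim (auto simp: indicator_def)
    moreover have "(0::real)^(2*k) = 0" using False by simp
    ultimately show ?thesis
      by (subst nn_integral_cong_AE[where v = "\<lambda>t. indicator (ball 0 r) w * (ennreal (d t) * indicator {0..cmod w} t)"])
         (simp_all add: nn_integral_cmult)
  qed
  have 2: "(\<integral>\<^sup>+w. (indicator {0<..} t * indicator {0..<r} (cmod w) * indicator {..cmod w} t) * ennreal (d t) \<partial>(lborel::complex measure))
       = ennreal (pi * (r\<^sup>2 - t\<^sup>2) * d t) * indicator {0<..r} t" for t :: real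
  proof (cases "0 < t \<and> t \<le> r")
    case True
    have "(indicator {0<..} t * indicator {0..<r} (cmod w) * indicator {..cmod w} t) * ennreal (d t)
        = ennreal (d t) * indicator (ball 0 r - ball 0 t) w" for w :: complex
      using True by (auto simp: indicator_def)
    then have "(\<integral>\<^sup>+w. (indicator {0<..} t * indicator {0..<r} (cmod w) * indicator {..cmod w} t) * ennreal (d t) \<partial>(lborel::complex measure))
       = ennreal (d t) * emeasure lborel (ball 0 r - ball 0 t :: complex set)"
      by (simp add: nn_integral_cmult_indicator)
    also have "emeasure lborel (ball 0 r - ball 0 t :: complex set) = ennreal (pi * (r\<^sup>2 - t\<^sup>2))"
      using True assms by (subst emeasure_Diff) 
        (auto simp: emeasure_ball unit_ball_vol_2 ennreal_minus algebra_simps)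
    also have "ennreal (d t) * ennreal (pi * (r\<^sup>2 - t\<^sup>2)) = ennreal (pi * (r\<^sup>2 - t\<^sup>2) * d t)"
      using True d0[of t] by (simp add: ennreal_mult' [symmetric] mult.commute)
    finally show ?thesis using True by simp
  next
    case False
    have z: "(indicator {0<..} t * indicator {0..<r} (cmod w) * indicator {..cmod w} t) * ennreal (d t) = 0" for w :: complex
      using False by (auto simp: indicator_def)
    show ?thesis unfolding z using False by simp
  qed
  \<comment> \<open>an antiderivative of the area of the annulus times the density\<close>
  define G where "G t = pi * (r\<^sup>2 * t^(2*k) - real k / real (k+1) * t^(2*k+2))" for t :: real
  have G: "(G has_real_derivative pi * (r\<^sup>2 - t\<^sup>2) * d t) (at t)" for t
  proof -
    have "t^(2*k+1) = t^2 * t^(2*k-1)" using False by (simp flip: power_add)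
    moreover have "real k / real (k+1) * real (2*k+2) = 2 * real k" by (simp add: field_simps)
    ultimately have "real k / real (k+1) * (real (2*k+2) * t^(2*k+1)) = t\<^sup>2 * d t"
      unfolding d_def by (metis (no_types, opaque_lifting) mult.assoc mult.left_commute of_nat_mult of_nat_numeral)
    then have "(pi * (r\<^sup>2 - t\<^sup>2) * d t) = pi * (r\<^sup>2 * d t - real k / real (k+1) * (real (2*k+2) * t^(2*k+1)))"
      by (simp add: algebra_simps)
    moreover have "((\<lambda>t. t^(2*k+2)) has_real_derivative real (2*k+2) * t^(2*k+1)) (at t)"
      using DERIV_pow[of "2*k+2" t] by simp
    then have "(G has_real_derivative pi * (r\<^sup>2 * d t - real k / real (k+1) * (real (2*k+2) * t^(2*k+1)))) (at t)"
      unfolding G_def by (intro DERIV_cmult DERIV_diff d)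
    ultimately show ?thesis by (simp only:)
  qed
  have "(\<integral>\<^sup>+w\<in>ball 0 r. ennreal (cmod w ^ (2*k)) \<partial>lborel)
     = (\<integral>\<^sup>+w. \<integral>\<^sup>+t. (indicator {0<..} t * indicator {0..<r} (cmod w) * indicator {..cmod w} t) * ennreal (d t) \<partial>lborel \<partial>lborel)"
    by (intro nn_integral_cong) (metis 1 mult.commute)
  also have "\<dots> = (\<integral>\<^sup>+t. \<integral>\<^sup>+w. (indicator {0<..} t * indicator {0..<r} (cmod w) * indicator {..cmod w} t) * ennreal (d t) \<partial>(lborel::complex measure) \<partial>lborel)"
    by (rule lborel_pair.Fubini'[symmetric]) (simp add: indicator_def, measurable)
  also have "\<dots> = (\<integral>\<^sup>+t. ennreal (pi * (r\<^sup>2 - t\<^sup>2) * d t) * indicator {0<..r} t \<partial>lborel)"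
    unfolding 2 ..
  also have "\<dots> = (\<integral>\<^sup>+t. ennreal (pi * (r\<^sup>2 - t\<^sup>2) * d t) * indicator {0..r} t \<partial>lborel)"
    using AE_lborel_singleton[of "0::real"] by (intro nn_integral_cong_AE, eventually_elim) (auto simp: indicator_def)
  also have "\<dots> = ennreal (G r - G 0)"
    using assms G d0
    by (intro nn_integral_FTC_Icc) (auto intro!: mult_nonneg_nonneg power_mono)
  also have "G r - G 0 = pi * r^(2*k+2) / (k+1)"
  proof -
    have "G 0 = 0" using False by (simp add: G_def)
    moreover have "1 - real k / real (k+1) = 1 / real (k+1)" by (simp add: field_simps)
    moreover have "r\<^sup>2 * r^(2*k) = r^(2*k+2)" by (simp add: power_add power2_eq_square)
    then have "G r = pi * (r^(2*k+2) * (1 - real k / real (k+1)))"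
    proof -
      have "X - q * X = X * (1 - q)" for X q :: real by (simp add: algebra_simps)
      then show ?thesis unfolding G_def using \<open>r\<^sup>2 * r^(2*k) = r^(2*k+2)\<close> by (simp only:)
    qed
    ultimately show ?thesis by simp
  qed
  finally show ?thesis .
qed

text \<open>
  The off-diagonal moments vanish because the rotation by the angle \<pi> / (j - k) preserves the
  disc and multiplies the integrand by -1.
\<close>

lemma disc_moment:
  fixes r :: real
  assumes "r \<ge> 0"
  shows "set_integrable lborel (ball 0 r) (\<lambda>w. w^j * cnj w^k)"
    and "(LINT w:ball 0 r|lborel. w^j * cnj w^k) = 
           (if j = k then of_real (pi * r^(2*j+2) / (j+1)) else 0)"
proof -
  have b: "cmod (w^j * cnj w^k) \<le> r^(j+k)" if "w \<in> ball 0 r" for w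
    using that assms by (auto simp: norm_mult norm_power power_add intro!: mult_mono power_mono)
  show si: "set_integrable lborel (ball 0 r) (\<lambda>w. w^j * cnj w^k)"
    by (rule set_integrable_bounded_continuous[OF _ _ _ b]) (auto intro!: continuous_intros)
  show "(LINT w:ball 0 r|lborel. w^j * cnj w^k) = 
           (if j = k then of_real (pi * r^(2*j+2) / (j+1)) else 0)"
  proof (cases "j = k")
    case True
    have e: "w^j * cnj w^k = of_real (cmod w ^ (2*k))" for w
      unfolding True power_mult_distrib[symmetric] complex_norm_square[symmetric]
      by (simp add: power_mult)
    have "(LINT w:ball 0 r|lborel. w^j * cnj w^k) = of_real (LINT w:ball 0 r|lborel. cmod w ^ (2*k))"
      unfolding e set_lebesgue_integral_def integral_complex_of_real[symmetric] 
      by (simp add: scaleR_conv_of_real) 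
    also have "(LINT w:ball 0 r|lborel. cmod w ^ (2*k)) = pi * r^(2*k+2) / (k+1)"
    proof -
      have "(LINT w:ball 0 r|lborel. cmod w ^ (2*k)) = enn2real (\<integral>\<^sup>+w. ennreal (indicator (ball 0 r) w * (cmod w ^ (2*k))) \<partial>lborel)"
        unfolding set_lebesgue_integral_def real_scaleR_def
        by (subst integral_eq_nn_integral) (auto intro!: borel_measurable_times borel_measurable_indicator)
      also have "(\<integral>\<^sup>+w. ennreal (indicator (ball 0 r) w * (cmod w ^ (2*k))) \<partial>lborel) = ennreal (pi * r^(2*k+2) / (k+1))"
        by (subst disc_moment_diag[OF assms, symmetric]) 
           (auto intro!: nn_integral_cong simp: ennreal_mult' indicator_def)
      finally show ?thesis using assms by simp
    qed
    finally show ?thesis using True by simp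
  next
    case False
    \<comment> \<open>a rotation with c^j cnj c^k = cis \<pi> = -1\<close>
    define c where "c = cis (pi / (real j - real k))"
    have c1: "cmod c = 1" by (simp add: c_def)
    have cm: "c^j * cnj c^k = -1"
    proof -
      have "cis x ^ n = cis (real n * x)" for x n by (rule Complex.DeMoivre)
      then have "c^j * cnj c^k = cis (real j * (pi / (real j - real k)) - real k * (pi / (real j - real k)))"
        by (simp only: c_def cis_cnj cis_mult diff_conv_add_uminus mult_minus_right)
      also have "real j * (pi / (real j - real k)) - real k * (pi / (real j - real k)) = pi"
      proof -
        have "real j - real k \<noteq> 0" using False by simp
        moreover have "real j * (pi / (real j - real k)) - real k * (pi / (real j - real k)) 
            = (real j - real k) * (pi / (real j - real k))" by (simp only: left_diff_distrib)
        ultimately show ?thesis by simp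
      qed
      finally show ?thesis by simp
    qed
    have cne: "c \<noteq> 0" using c1 by auto
    have img: "(*) c ` ball 0 r = ball 0 r"
    proof (intro equalityI subsetI)
      fix w :: complex assume "w \<in> ball 0 r"
      then show "w \<in> (*) c ` ball 0 r"
        using c1 cne by (intro image_eqI[of _ _ "w / c"]) (auto simp: norm_divide)
    qed (use c1 in \<open>auto simp: norm_mult\<close>)
    have "(LINT w:((*) c ` ball 0 r)|lborel. w^j * cnj w^k) 
      = (LINT w:ball 0 r|lborel. (cmod (deriv ((*) c) w))\<^sup>2 *\<^sub>R ((c * w)^j * cnj (c * w)^k))"
      by (rule conformal_change_of_variables(2)) 
         (use cne in \<open>auto intro!: holomorphic_intros continuous_intros simp: inj_on_def\<close>)
    also have "\<dots> = (LINT w:ball 0 r|lborel. - (w^j * cnj w^k))"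
    proof -
      have "(c * w)^j * cnj (c * w)^k = (c^j * cnj c^k) * (w^j * cnj w^k)" for w
        by (simp add: power_mult_distrib)
      then show ?thesis unfolding cm by (simp add: c1)
    qed
    also have "\<dots> = - (LINT w:ball 0 r|lborel. w^j * cnj w^k)"
      unfolding set_lebesgue_integral_def by simp
    finally show ?thesis unfolding img using False by simp
  qed
qed

text \<open>
  The monomials are orthogonal on every smaller disc, on which the partial sums converge
  boundedly; the radius then tends to 1.
\<close>

lemma bergman_Bessel:
  fixes b :: "nat \<Rightarrow> complex"
  assumes sums: "\<And>w. cmod w < 1 \<Longrightarrow> (\<lambda>n. b n * w^n) sums f w"
    and i: "set_integrable lborel (ball 0 1) (\<lambda>w. (cmod (f w))\<^sup>2)"
  shows "pi * (\<Sum>n\<le>N. (cmod (b n))\<^sup>2 / real (n + 1)) \<le> (LINT w:ball 0 1|lborel. (cmod (f w))\<^sup>2)"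
proof -
  define S where "S N w = (\<Sum>n\<le>N. b n * w^n)" for N w
  have bd: "pi * (\<Sum>n\<le>K. (cmod (b n))\<^sup>2 * r^(2*n+2) / real (n + 1)) \<le> (LINT w:ball 0 1|lborel. (cmod (f w))\<^sup>2)"
    if r: "0 \<le> r" "r < 1" for r K
  proof -
    define v where "v N = pi * (\<Sum>n\<le>N. (cmod (b n))\<^sup>2 * r^(2*n+2) / real (n + 1))" for N
    have S2: "complex_of_real ((cmod (S N w))\<^sup>2) = (\<Sum>m\<le>N. \<Sum>n\<le>N. (b m * cnj (b n)) * (w^m * cnj w^n))" for N w
      unfolding complex_norm_square S_def by (simp add: cnj_sum sum_product mult_ac)
    have iS: "integrable lborel (\<lambda>w. indicator (ball 0 r) w *\<^sub>R ((b m * cnj (b n)) * (w^m * cnj w^n)))" for m n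
      using set_integrable_mult_right[OF disc_moment(1)[OF r(1)], of "b m * cnj (b n)" m n] by (simp only: set_integrable_def)
    have "complex_of_real (LINT w:ball 0 r|lborel. (cmod (S N w))\<^sup>2) = (LINT w:ball 0 r|lborel. complex_of_real ((cmod (S N w))\<^sup>2))" for N
      unfolding set_lebesgue_integral_def scaleR_complex_of_real integral_complex_of_real ..
    also have "\<dots> N = (\<Sum>m\<le>N. \<Sum>n\<le>N. (LINT w:ball 0 r|lborel. (b m * cnj (b n)) * (w^m * cnj w^n)))" for N
      unfolding S2 set_lebesgue_integral_def scaleR_sum_right
      by (simp only: Bochner_Integration.integral_sum Bochner_Integration.integrable_sum iS)
    also have "\<dots> N = (\<Sum>m\<le>N. \<Sum>n\<le>N. if m = n then of_real (pi * ((cmod (b m))\<^sup>2 * r^(2*m+2) / real (m + 1))) else 0)" for N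
      by (intro sum.cong refl) (simp add: disc_moment(2)[OF r(1)] complex_norm_square del: of_real_power)
    also have "\<dots> N = of_real (v N)" for N
      by (simp add: v_def sum_distrib_left sum.delta)
    finally have vS: "(LINT w:ball 0 r|lborel. (cmod (S N w))\<^sup>2) = v N" for N
      using of_real_eq_iff by blast
    have sm: "summable (\<lambda>n. cmod (b n) * r^n)"
    proof -
      have "summable (\<lambda>n. b n * (of_real ((1+r)/2))^n)"
        using sums[of "of_real ((1+r)/2)"] r by (auto simp: sums_iff simp del: of_real_divide of_real_add of_real_power)
      moreover have "norm (complex_of_real r) < norm (complex_of_real ((1+r)/2))"
        unfolding norm_of_real using r by simp
      ultimately have "summable (\<lambda>n. norm (b n * (of_real r)^n))" by (rule powser_insidea)
      then show ?thesis using r by (simp add: norm_mult norm_power)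
    qed
    define B where "B = (\<Sum>n. cmod (b n) * r^n)"
    have SB: "cmod (S N w) \<le> B" if "w \<in> ball 0 r" for N w
    proof -
      have "cmod (S N w) \<le> (\<Sum>n\<le>N. cmod (b n) * r^n)"
        unfolding S_def using that by (intro order_trans[OF norm_sum] sum_mono) 
          (auto simp: norm_mult norm_power intro!: mult_left_mono power_mono)
      also have "\<dots> \<le> B" unfolding B_def using r by (intro sum_le_suminf sm) auto
      finally show ?thesis .
    qed
    have "(\<lambda>N. LINT w:ball 0 r|lborel. (cmod (S N w))\<^sup>2) \<longlonglongrightarrow> (LINT w:ball 0 r|lborel. (cmod (f w))\<^sup>2)"
      unfolding set_lebesgue_integral_def
    proof (rule integral_dominated_convergence[where w="\<lambda>w. indicator (ball 0 r) w *\<^sub>R B\<^sup>2"])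
      have "(\<lambda>w. indicat_real (ball 0 1) w *\<^sub>R (cmod (f w))\<^sup>2) \<in> borel_measurable borel"
        using i by (auto simp: set_integrable_def dest: borel_measurable_integrable)
      then have "(\<lambda>w. indicat_real (ball 0 r) w *\<^sub>R (indicat_real (ball 0 1) w *\<^sub>R (cmod (f w))\<^sup>2)) \<in> borel_measurable borel"
        by (rule borel_measurable_scaleR[OF borel_measurable_indicator[OF borel_open[OF open_ball]]])
      moreover have "indicat_real (ball 0 r) w *\<^sub>R (indicat_real (ball 0 1) w *\<^sub>R (cmod (f w))\<^sup>2) = indicat_real (ball 0 r) w *\<^sub>R (cmod (f w))\<^sup>2" for w
        using r by (auto simp: indicator_def)
      ultimately show "(\<lambda>w. indicat_real (ball 0 r) w *\<^sub>R (cmod (f w))\<^sup>2) \<in> borel_measurable lborel"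
        by (simp only: measurable_lborel1 measurable_lborel2)
      show "(\<lambda>w. indicat_real (ball 0 r) w *\<^sub>R (cmod (S N w))\<^sup>2) \<in> borel_measurable lborel" for N
        unfolding S_def by (intro borel_measurable_scaleR borel_measurable_indicator) (auto intro!: borel_measurable_continuous_onI continuous_intros)
      show "integrable lborel (\<lambda>w. indicat_real (ball (0::complex) r) w *\<^sub>R B\<^sup>2)"
        using emeasure_bounded_finite[of "ball (0::complex) r"] by (intro integrable_scaleR_left integrable_real_indicator) auto
      show "AE w in lborel. (\<lambda>N. indicat_real (ball 0 r) w *\<^sub>R (cmod (S N w))\<^sup>2) \<longlonglongrightarrow> indicat_real (ball 0 r) w *\<^sub>R (cmod (f w))\<^sup>2"
      proof (rule AE_I2)
        fix w
        show "(\<lambda>N. indicat_real (ball 0 r) w *\<^sub>R (cmod (S N w))\<^sup>2) \<longlonglongrightarrow> indicat_real (ball 0 r) w *\<^sub>R (cmod (f w))\<^sup>2"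
        proof (cases "w \<in> ball 0 r")
          case True
          then have "(\<lambda>N. S N w) \<longlonglongrightarrow> f w"
            using sums[of w] r unfolding sums_def_le S_def by simp
          then show ?thesis by (intro tendsto_intros)
        qed simp
      qed
      show "AE w in lborel. norm (indicat_real (ball 0 r) w *\<^sub>R (cmod (S N w))\<^sup>2) \<le> indicat_real (ball 0 r) w *\<^sub>R B\<^sup>2" for N
      proof (rule AE_I2)
        fix w show "norm (indicat_real (ball 0 r) w *\<^sub>R (cmod (S N w))\<^sup>2) \<le> indicat_real (ball 0 r) w *\<^sub>R B\<^sup>2"
          using SB[of w N] by (auto simp: indicator_def intro: power_mono)
      qed
    qed
    then have lim: "v \<longlonglongrightarrow> (LINT w:ball 0 r|lborel. (cmod (f w))\<^sup>2)" unfolding vS .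
    have "v K \<le> (LINT w:ball 0 r|lborel. (cmod (f w))\<^sup>2)"
    proof (rule LIMSEQ_le_const[OF lim], intro exI allI impI)
      fix n assume "K \<le> n"
      then show "v K \<le> v n" unfolding v_def using r
        by (intro mult_left_mono sum_mono2) auto
    qed
    also have "\<dots> \<le> (LINT w:ball 0 1|lborel. (cmod (f w))\<^sup>2)"
    proof -
      have "set_integrable lborel (ball 0 r) (\<lambda>w. (cmod (f w))\<^sup>2)"
        by (rule set_integrable_subset[OF i]) (use r in auto)
      then show ?thesis using i r unfolding set_lebesgue_integral_def set_integrable_def
        by (intro integral_mono) (auto simp: indicator_def)
    qed
    finally show ?thesis unfolding v_def .
  qed
  have "((\<lambda>r. pi * (\<Sum>n\<le>N. (cmod (b n))\<^sup>2 * r^(2*n+2) / real (n + 1))) \<longlongrightarrow> pi * (\<Sum>n\<le>N. (cmod (b n))\<^sup>2 * 1^(2*n+2) / real (n + 1))) (at_left 1)"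
    by (intro tendsto_intros) auto
  moreover have "\<forall>\<^sub>F r in at_left (1::real). pi * (\<Sum>n\<le>N. (cmod (b n))\<^sup>2 * r^(2*n+2) / real (n + 1)) \<le> (LINT w:ball 0 1|lborel. (cmod (f w))\<^sup>2)"
    by (rule eventually_mono[OF eventually_at_left_real[OF zero_less_one]]) (use bd in auto)
  ultimately show ?thesis
    using tendsto_upperbound[of _ _ "at_left (1::real)"] by fastforce
qed

section \<open>A quadratic form on antidiagonals\<close>

text \<open>
  Raising p and q by one raises each of the p + q + 1 summands by one, up to a shift of r, in
  accordance with (p+1)(q+1) - p q = p + q + 1.
\<close>

lemma sum_min_antidiagonal:
  fixes p q :: nat
  shows "(\<Sum>r\<le>p+q. min (min p q) (min r (p+q-r))) = p*q"
proof (induction p arbitrary: q)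
  case 0
  show ?case by simp
next
  case (Suc p)
  show ?case
  proof (cases q)
    case 0
    then show ?thesis by simp
  next
    case (Suc q')
    have *: "min (min (Suc p) (Suc q')) (min (Suc r) (p + q' + 1 - r)) =
              Suc (min (min p q') (min r (p+q'-r)))" if "r \<le> p+q'" for r
      using that by (auto simp: min_def)
    have "(\<Sum>r\<le>Suc p + Suc q'. min (min (Suc p) (Suc q')) (min r (Suc p + Suc q' - r)))
       = (\<Sum>r\<le>Suc (p+q'). min (min (Suc p) (Suc q')) (min r (Suc p + Suc q' - r)))"
      by simp
    also have "\<dots> = (\<Sum>r\<le>p+q'. min (min (Suc p) (Suc q')) (min (Suc r) (p + q' + 1 - r)))"
      by (subst sum.atMost_Suc_shift) simp
    also have "\<dots> = (\<Sum>r\<le>p+q'. Suc (min (min p q') (min r (p+q'-r))))"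
      by (intro sum.cong refl *) auto
    also have "\<dots> = (p+q'+1) + (\<Sum>r\<le>p+q'. min (min p q') (min r (p+q'-r)))"
      by (simp add: sum_Suc)
    also have "\<dots> = Suc p * Suc q'" using Suc.IH[of q'] by simp
    finally show ?thesis using Suc by simp
  qed
qed

text \<open>
  On an antidiagonal, p r \<le> q s holds iff r \<le> q, and p s \<le> q r iff p \<le> r.  The position of r
  relative to p and q thus decides both minima, and the sum always has a common factor.
\<close>

lemma min_products_symmetrised:
  fixes p q r s :: nat
  assumes "p + q = r + s"
  shows "min (p*r) (q * s) + min (q*r) (p * s) = (p+q) * min (min p q) (min r s)"
proof -
  have min1: "min (p*r) (q * s) = (if r \<le> q then p*r else q * s)"
  proof (cases "r \<le> q")
    case True
    then have "p*r \<le> s*q" using assms by (intro mult_le_mono) auto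
    then show ?thesis using True by (simp add: mult.commute)
  next
    case False
    then have "s*q \<le> p*r" using assms by (intro mult_le_mono) auto
    then show ?thesis using False by (simp add: mult.commute)
  qed
  have min2: "min (q*r) (p * s) = (if p \<le> r then p * s else q*r)"
  proof (cases "p \<le> r")
    case True
    then have "p * s \<le> r*q" using assms by (intro mult_le_mono) auto
    then show ?thesis using True by (simp add: mult.commute)
  next
    case False
    then have "r*q \<le> p * s" using assms by (intro mult_le_mono) auto
    then show ?thesis using False by (simp add: mult.commute)
  qed
  have min4: "min (min p q) (min r s) = 
      (if r \<le> q then if p \<le> r then p else r else if p \<le> r then s else q)"
    using assms by (auto simp: min_def)
  have "p*r + p * s = (r+s)*p" "q * s + q*r = (r+s)*q" "p*r + q*r = (p+q)*r" "q * s + p * s = (p+q) * s"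
    by (simp_all add: algebra_simps)
  then show ?thesis unfolding min1 min2 min4 using assms by simp
qed

text \<open>
  Exchanging p and q replaces the kernel by the average of the two minima of products, which is
  half the minimum of the four indices.  Schur's test, that is
  2 (x p x q) (x r x s) \<le> (x p x q)^2 + (x r x s)^2, then reduces the claim to the row sums, which
  \<open>sum_min_antidiagonal\<close> evaluates exactly.
\<close>

lemma antidiagonal_form_bound:
  fixes x :: "nat \<Rightarrow> real" and M :: nat
  assumes x0: "\<And>n. x n \<ge> 0"
  defines "A \<equiv> {..M}"
  shows "(\<Sum>p\<in>A. \<Sum>q\<in>A. \<Sum>r\<in>A. \<Sum>s\<in>A. if p + q = r + s
            then real (min (p*r) (q * s)) / real (p+q) * (x p * x q * x r * x s) else 0)
         \<le> (\<Sum>n\<in>A. real n * (x n)\<^sup>2)\<^sup>2 / 2"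
proof -
  define m where "m p q r s = real (min (min p q) (min r s))" for p q r s :: nat
  define f where "f p q r s = (if p + q = r + s
            then real (min (p*r) (q * s)) / real (p+q) * (x p * x q * x r * x s) else 0)" for p q r s
  define h where "h p q r s = (if p + q = r + s then m p q r s * ((x p)\<^sup>2 * (x q)\<^sup>2) else 0)" for p q r s
  let ?S = "\<lambda>f. \<Sum>p\<in>A. \<Sum>q\<in>A. \<Sum>r\<in>A. \<Sum>s\<in>A. (f p q r s :: real)"
  \<comment> \<open>symmetrisation in p and q; note that x p x q x r x s is unaffected\<close>
  have swap: "?S f = ?S (\<lambda>p q r s. f q p r s)" by (rule sum.swap)
  have pair: "(\<Sum>p\<in>A. \<Sum>q\<in>A. g p q) = (\<Sum>z\<in>A\<times>A. g (fst z) (snd z))" for g :: "nat \<Rightarrow> nat \<Rightarrow> real"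
    by (simp add: sum.cartesian_product case_prod_unfold)
  have sym: "?S (\<lambda>p q r s. h r s p q) = ?S h"
    unfolding pair by (rule sum.swap)
  have pt: "f p q r s + f q p r s \<le> (h p q r s + h r s p q) / 2" for p q r s
  proof (cases "p + q = r + s")
    case True
    have e: "f p q r s + f q p r s = m p q r s * (x p * x q * x r * x s)"
    proof (cases "p + q = 0")
      case False
      have "real (min (p*r) (q * s)) + real (min (q*r) (p * s)) = real (p+q) * m p q r s"
        unfolding m_def using min_products_symmetrised[OF True]
        by (metis of_nat_add of_nat_mult)
      then have "real (min (p*r) (q * s)) / real (p+q) + real (min (q*r) (p * s)) / real (p+q) = m p q r s"
        using False by (simp add: field_simps flip: add_divide_distrib del: of_nat_add of_nat_mult)
      then have "(real (min (p*r) (q * s)) / real (p+q) + real (min (q*r) (p * s)) / real (p+q)) * (x p * x q * x r * x s) 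
           = m p q r s * (x p * x q * x r * x s)" by simp
      then show ?thesis unfolding f_def using True 
        by (simp add: add.commute[of q p] algebra_simps del: of_nat_add of_nat_mult)
    qed (auto simp: f_def m_def)
    have "2 * (x p * x q * x r * x s) \<le> (x p * x q)\<^sup>2 + (x r * x s)\<^sup>2"
      using sum_squares_bound[of "x p * x q" "x r * x s"] by (simp add: mult_ac)
    then have "m p q r s * (2 * (x p * x q * x r * x s)) \<le> m p q r s * ((x p * x q)\<^sup>2 + (x r * x s)\<^sup>2)"
      by (intro mult_left_mono) (auto simp: m_def)
    moreover have "m r s p q = m p q r s" by (simp add: m_def min.commute)
    ultimately show ?thesis unfolding e using True 
      by (simp add: h_def algebra_simps)
  qed (simp add: f_def h_def)
  have "2 * ?S f = ?S f + ?S (\<lambda>p q r s. f q p r s)" using swap by simp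
  also have "\<dots> = ?S (\<lambda>p q r s. f p q r s + f q p r s)" by (simp only: sum.distrib)
  also have "\<dots> \<le> ?S (\<lambda>p q r s. (h p q r s + h r s p q) / 2)"
    by (intro sum_mono pt)
  also have "\<dots> = (?S h + ?S (\<lambda>p q r s. h r s p q)) / 2"
    by (simp only: sum.distrib sum_divide_distrib[symmetric])
  also have "\<dots> = ?S h" unfolding sym by simp
  also have "\<dots> \<le> (\<Sum>p\<in>A. \<Sum>q\<in>A. (real p * (x p)\<^sup>2) * (real q * (x q)\<^sup>2))"
  proof (intro sum_mono)
    fix p q
    have "(\<Sum>r\<in>A. \<Sum>s\<in>A. h p q r s) 
        = (\<Sum>r\<in>A. \<Sum>s\<in>A. (x p)\<^sup>2 * (x q)\<^sup>2 * (if s = p + q - r \<and> r \<le> p + q then m p q r s else 0))"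
      by (intro sum.cong refl) (auto simp: h_def)
    also have "\<dots> \<le> (\<Sum>r\<in>A. (x p)\<^sup>2 * (x q)\<^sup>2 * (if r \<le> p + q then m p q r (p+q-r) else 0))"
    proof (rule sum_mono)
      fix r
      have "(\<Sum>s\<in>A. (if s = p + q - r \<and> r \<le> p + q then m p q r s else 0)) 
           \<le> (if r \<le> p + q then m p q r (p+q-r) else 0)"
        by (cases "r \<le> p + q") (auto simp: A_def m_def sum.delta)
      then show "(\<Sum>s\<in>A. (x p)\<^sup>2 * (x q)\<^sup>2 * (if s = p + q - r \<and> r \<le> p + q then m p q r s else 0))
         \<le> (x p)\<^sup>2 * (x q)\<^sup>2 * (if r \<le> p + q then m p q r (p+q-r) else 0)"
        by (simp only: sum_distrib_left[symmetric]) (intro mult_left_mono; simp)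
    qed
    also have "\<dots> = (x p)\<^sup>2 * (x q)\<^sup>2 * (\<Sum>r\<in>A. if r \<le> p + q then m p q r (p+q-r) else 0)"
      by (simp add: sum_distrib_left)
    also have "\<dots> \<le> (x p)\<^sup>2 * (x q)\<^sup>2 * (\<Sum>r\<le>p+q. m p q r (p+q-r))"
    proof (intro mult_left_mono)
      have "(\<Sum>r\<in>A. if r \<le> p + q then m p q r (p+q-r) else 0) = (\<Sum>r\<in>A\<inter>{..p+q}. m p q r (p+q-r))"
        by (subst sum.inter_restrict) (auto simp: A_def)
      also have "\<dots> \<le> (\<Sum>r\<le>p+q. m p q r (p+q-r))"
        by (intro sum_mono2) (auto simp: m_def)
      finally show "(\<Sum>r\<in>A. if r \<le> p + q then m p q r (p+q-r) else 0) \<le> \<dots>" .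
    qed simp
    also have "(\<Sum>r\<le>p+q. m p q r (p+q-r)) = real p * real q"
      unfolding m_def of_nat_sum[symmetric] sum_min_antidiagonal by simp
    finally show "(\<Sum>r\<in>A. \<Sum>s\<in>A. h p q r s) \<le> (real p * (x p)\<^sup>2) * (real q * (x q)\<^sup>2)"
      by (simp add: mult_ac)
  qed
  also have "\<dots> = (\<Sum>n\<in>A. real n * (x n)\<^sup>2)\<^sup>2"
    by (simp add: power2_eq_square sum_product)
  finally show ?thesis unfolding f_def by simp
qed

section \<open>The analytic part of the squared modulus of a power series\<close>

lemma sum_shift_triangle:
  fixes f :: "nat \<Rightarrow> nat \<Rightarrow> 'a::comm_monoid_add"
  shows "(\<Sum>k\<le>N. \<Sum>m\<le>N. if m + k \<le> N then f m k else 0) = (\<Sum>m\<le>N. \<Sum>n\<le>N. if m \<le> n then f m (n - m) else 0)"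
proof (subst sum.swap, rule sum.cong[OF refl])
  fix m assume "m \<in> {..N}"
  have "(\<Sum>k\<le>N. if m + k \<le> N then f m k else 0) = (\<Sum>k | k \<in> {..N} \<and> m + k \<le> N. f m k)"
    by (rule sum.inter_filter[symmetric]) simp
  also have "\<dots> = (\<Sum>n | n \<in> {..N} \<and> m \<le> n. f m (n - m))"
    by (rule sum.reindex_bij_witness[of _ "\<lambda>n. n - m" "\<lambda>k. m + k"]) auto
  also have "\<dots> = (\<Sum>n\<le>N. if m \<le> n then f m (n - m) else 0)"
    by (rule sum.inter_filter) simp
  finally show "(\<Sum>k\<le>N. if m + k \<le> N then f m k else 0) = (\<Sum>n\<le>N. if m \<le> n then f m (n - m) else 0)" .
qed

definition autocorr :: "(nat \<Rightarrow> complex) \<Rightarrow> nat \<Rightarrow> complex" where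
  "autocorr a k = (\<Sum>m. cnj (a m) * a (m + k))"

definition autocorr_upto :: "nat \<Rightarrow> (nat \<Rightarrow> complex) \<Rightarrow> nat \<Rightarrow> complex" where
  "autocorr_upto N a k = (\<Sum>m\<le>N. if m + k \<le> N then cnj (a m) * a (m + k) else 0)"

text \<open>
  This is the projection to nonnegative frequencies of the squared modulus, on the unit circle,
  of the polynomial with coefficients a(0), ..., a(N).  The function \<open>proj_series\<close> below is its
  limit.
\<close>

definition proj_upto :: "nat \<Rightarrow> (nat \<Rightarrow> complex) \<Rightarrow> complex \<Rightarrow> complex" where
  "proj_upto N a w = (\<Sum>k\<le>N. autocorr_upto N a k * w^k)"

definition proj_series :: "(nat \<Rightarrow> complex) \<Rightarrow> complex \<Rightarrow> complex" where
  "proj_series a w = (\<Sum>k. autocorr a k * w^k)"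

lemma autocorr_bound:
  assumes s: "summable (\<lambda>n. (cmod (a n))\<^sup>2)"
  shows "summable (\<lambda>m. cmod (cnj (a m) * a (m + k)))"
    and "cmod (autocorr_upto N a k) \<le> (\<Sum>n. (cmod (a n))\<^sup>2)"
    and "(\<lambda>N. autocorr_upto N a k) \<longlonglongrightarrow> autocorr a k"
proof -
  let ?C = "\<Sum>n. (cmod (a n))\<^sup>2"
  have sk: "summable (\<lambda>n. (cmod (a (n + k)))\<^sup>2)" by (rule summable_ignore_initial_segment[OF s])
  have b: "cmod (cnj (a m) * a (m + k)) \<le> ((cmod (a m))\<^sup>2 + (cmod (a (m+k)))\<^sup>2) / 2" for m
    using sum_squares_bound[of "cmod (a m)" "cmod (a (m+k))"] by (simp add: norm_mult)
  have sb: "summable (\<lambda>m. ((cmod (a m))\<^sup>2 + (cmod (a (m+k)))\<^sup>2) / 2)"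
    by (intro summable_divide summable_add s sk)
  show 1: "summable (\<lambda>m. cmod (cnj (a m) * a (m + k)))"
    by (rule summable_comparison_test'[OF sb, of 0]) (use b in auto)
  have shift: "(\<Sum>m. (cmod (a (m+k)))\<^sup>2) \<le> ?C"
    using suminf_split_initial_segment[OF s, of k] sum_nonneg[of "{..<k}" "\<lambda>n. (cmod (a n))\<^sup>2"] by simp
  have "cmod (autocorr_upto N a k) \<le> (\<Sum>m\<le>N. cmod (if m + k \<le> N then cnj (a m) * a (m + k) else 0))"
    unfolding autocorr_upto_def by (rule norm_sum)
  also have "\<dots> \<le> (\<Sum>m\<le>N. cmod (cnj (a m) * a (m + k)))" by (intro sum_mono) auto
  also have "\<dots> \<le> (\<Sum>m. cmod (cnj (a m) * a (m + k)))" by (intro sum_le_suminf 1) auto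
  also have "\<dots> \<le> (\<Sum>m. ((cmod (a m))\<^sup>2 + (cmod (a (m+k)))\<^sup>2) / 2)" by (intro suminf_le b 1 sb)
  also have "\<dots> = (?C + (\<Sum>m. (cmod (a (m+k)))\<^sup>2)) / 2"
    by (simp add: suminf_divide[OF summable_add[OF s sk]] suminf_add[OF s sk])
  also have "\<dots> \<le> ?C" using shift by simp
  finally show "cmod (autocorr_upto N a k) \<le> ?C" .
  have "(\<lambda>N. \<Sum>m\<le>N. cnj (a m) * a (m + k)) \<longlonglongrightarrow> autocorr a k"
    unfolding autocorr_def by (rule summable_LIMSEQ'[OF summable_norm_cancel[OF 1]])
  moreover have "autocorr_upto (N + k) a k = (\<Sum>m\<le>N. cnj (a m) * a (m + k))" for N
    unfolding autocorr_upto_def by (rule sum.mono_neutral_cong_right) auto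
  ultimately have "(\<lambda>N. autocorr_upto (N + k) a k) \<longlonglongrightarrow> autocorr a k" by simp
  then show "(\<lambda>N. autocorr_upto N a k) \<longlonglongrightarrow> autocorr a k"
    by (rule LIMSEQ_offset)
qed

text \<open>
  For h(k) = w^k this is convergence of the projections, and for h(k) = k w^(k-1) that of their
  derivatives.
\<close>

lemma tannery_power_series:
  assumes s: "summable (\<lambda>n. (cmod (a n))\<^sup>2)" and h: "summable (\<lambda>k. cmod (h k))"
  shows "(\<lambda>N. \<Sum>k\<le>N. autocorr_upto N a k * h k) \<longlonglongrightarrow> (\<Sum>k. autocorr a k * h k)"
proof -
  let ?C = "\<Sum>n. (cmod (a n))\<^sup>2"
  have "(\<lambda>N. \<Sum>k. autocorr_upto N a k * h k) \<longlonglongrightarrow> (\<Sum>k. autocorr a k * h k)"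
  proof (rule tannerys_theorem[THEN conjunct2, THEN conjunct2])
    show "(\<lambda>N. autocorr_upto N a k * h k) \<longlonglongrightarrow> autocorr a k * h k" for k
      by (intro tendsto_mult tendsto_const autocorr_bound(3)[OF s])
    show "\<forall>\<^sub>F (k, N) in sequentially \<times>\<^sub>F sequentially. norm (autocorr_upto N a k * h k) \<le> ?C * cmod (h k)"
      using autocorr_bound(2)[OF s] by (intro always_eventually) (auto simp: norm_mult intro!: mult_right_mono)
    show "summable (\<lambda>k. ?C * cmod (h k))" by (intro summable_mult h)
  qed simp
  moreover have "(\<Sum>k. autocorr_upto N a k * h k) = (\<Sum>k\<le>N. autocorr_upto N a k * h k)" for N
    by (rule suminf_finite) (auto simp: autocorr_upto_def)
  ultimately show ?thesis by simp
qed

lemma summable_diff_geometric: 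
  assumes "cmod w < 1" shows "summable (\<lambda>k. cmod (of_nat k * w^(k-1)))"
proof -
  have g: "summable (\<lambda>k. 1 * x ^ k)" if "norm x < 1" for x :: complex
    using summable_geometric[OF that] by simp
  have "summable (\<lambda>k. diffs (\<lambda>_. 1) k * complex_of_real (cmod w) ^ k)"
    by (rule termdiff_converges[where K=1, OF _ g]) (use assms in simp_all)
  then have "summable (\<lambda>k. complex_of_real (real (Suc k) * cmod w ^ k))"
    by (simp only: diffs_def mult_1_right of_real_mult of_real_power of_real_of_nat_eq)
  then have "summable (\<lambda>k. real (Suc k) * cmod w ^ k)" by (simp only: summable_complex_of_real)
  then have "summable (\<lambda>k. cmod (of_nat (Suc k) * w^(Suc k - 1)))" 
    by (simp only: norm_mult norm_power norm_of_nat diff_Suc_1)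
  then show ?thesis
    using summable_Suc_iff[of "\<lambda>k. cmod (of_nat k * w^(k-1))"] by (simp only:)
qed

lemma proj_upto_tendsto:
  assumes s: "summable (\<lambda>n. (cmod (a n))\<^sup>2)" and w: "cmod w < 1"
  shows "(\<lambda>N. proj_upto N a w) \<longlonglongrightarrow> proj_series a w"
  unfolding proj_upto_def proj_series_def
proof (rule tannery_power_series[OF s])
  show "summable (\<lambda>k. cmod (w ^ k))" unfolding norm_power by (rule summable_geometric) (use w in simp)
qed

lemma proj_series_deriv:
  assumes s: "summable (\<lambda>n. (cmod (a n))\<^sup>2)" and w: "cmod w < 1"
  shows "(proj_series a has_field_derivative (\<Sum>k. autocorr a k * (of_nat k * w^(k-1)))) (at w)"
    and "(\<lambda>N. \<Sum>k\<le>N. autocorr_upto N a k * (of_nat k * w^(k-1))) \<longlonglongrightarrow> deriv (proj_series a) w"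
proof -
  let ?C = "\<Sum>n. (cmod (a n))\<^sup>2"
  have c: "cmod (autocorr a k) \<le> ?C" for k
    by (rule LIMSEQ_le_const2[OF tendsto_norm[OF autocorr_bound(3)[OF s]]]) (intro exI allI impI autocorr_bound(2)[OF s])
  have sm: "summable (\<lambda>k. autocorr a k * z^k)" if "cmod z < 1" for z
  proof (rule summable_norm_cancel, rule summable_comparison_test')
    show "summable (\<lambda>k. ?C * cmod z ^ k)" by (intro summable_mult summable_geometric) (use that in simp)
    show "norm (cmod (autocorr a k * z^k)) \<le> ?C * cmod z ^ k" for k
      using mult_right_mono[OF c[of k], of "cmod z ^ k"] by (simp add: norm_mult norm_power)
  qed
  have "(proj_series a has_field_derivative (\<Sum>k. diffs (autocorr a) k * w^k)) (at w)"
    unfolding proj_series_def[abs_def] 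
    by (rule termdiffs_strong'[where K=1, OF sm w])
  moreover have "(\<Sum>k. diffs (autocorr a) k * w^k) = (\<Sum>k. autocorr a k * (of_nat k * w^(k-1)))"
  proof -
    have 1: "summable (\<lambda>k. autocorr a k * (of_nat k * w^(k-1)))"
    proof (rule summable_norm_cancel, rule summable_comparison_test')
      show "summable (\<lambda>k. ?C * cmod (of_nat k * w^(k-1)))" by (intro summable_mult summable_diff_geometric w)
      show "norm (cmod (autocorr a k * (of_nat k * w^(k-1)))) \<le> ?C * cmod (of_nat k * w^(k-1))" for k
        unfolding norm_mult[of "autocorr a k"] real_norm_def abs_mult abs_norm_cancel by (intro mult_right_mono c) simp
    qed
    have 2: "(\<Sum>k. autocorr a (Suc k) * (of_nat (Suc k) * w^(Suc k-1))) = (\<Sum>k. autocorr a k * (of_nat k * w^(k-1)))"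
      using suminf_split_head[OF 1] by simp
    have "diffs (autocorr a) k * w^k = autocorr a (Suc k) * (of_nat (Suc k) * w^(Suc k-1))" for k
      unfolding diffs_def diff_Suc_1 by (rule trans[OF mult.assoc trans[OF mult.left_commute refl]])
    then show ?thesis by (intro trans[OF suminf_cong 2])
  qed
  ultimately show d: "(proj_series a has_field_derivative (\<Sum>k. autocorr a k * (of_nat k * w^(k-1)))) (at w)" by simp
  show "(\<lambda>N. \<Sum>k\<le>N. autocorr_upto N a k * (of_nat k * w^(k-1))) \<longlonglongrightarrow> deriv (proj_series a) w"
    unfolding DERIV_imp_deriv[OF d] by (rule tannery_power_series[OF s summable_diff_geometric[OF w]])
qed

lemma proj_series_holomorphic:
  assumes "summable (\<lambda>n. (cmod (a n))\<^sup>2)"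
  shows "proj_series a holomorphic_on ball 0 1"
  unfolding holomorphic_on_def
proof
  fix x :: complex assume "x \<in> ball 0 1"
  then have "cmod x < 1" by simp
  from proj_series_deriv(1)[OF assms this] show "proj_series a field_differentiable (at x within ball 0 1)"
    unfolding field_differentiable_def using has_field_derivative_at_within by blast
qed

section \<open>The potential and its decay at the circle\<close>

lemma cmod_add_square_le: "(cmod (x + y))\<^sup>2 \<le> 2 * (cmod x)\<^sup>2 + 2 * (cmod y)\<^sup>2"
proof -
  have "(cmod (x + y))\<^sup>2 \<le> (cmod x + cmod y)\<^sup>2" by (intro power_mono norm_triangle_ineq) simp
  also have "\<dots> \<le> 2 * (cmod x)\<^sup>2 + 2 * (cmod y)\<^sup>2"
    using sum_squares_bound[of "cmod x" "cmod y"] by (simp add: power2_sum)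
  finally show ?thesis .
qed

lemma autocorr_upto_sum:
  "(\<Sum>k\<le>N. autocorr_upto N a k * h k) = (\<Sum>m\<le>N. \<Sum>n\<le>N. if m \<le> n then cnj (a m) * a n * h (n - m) else 0)"
proof -
  have "(\<Sum>k\<le>N. autocorr_upto N a k * h k) = (\<Sum>k\<le>N. \<Sum>m\<le>N. if m + k \<le> N then cnj (a m) * a (m + k) * h k else 0)"
    unfolding autocorr_upto_def sum_distrib_right by (intro sum.cong refl) simp
  also have "\<dots> = (\<Sum>m\<le>N. \<Sum>n\<le>N. if m \<le> n then cnj (a m) * a (m + (n - m)) * h (n - m) else 0)"
    by (rule sum_shift_triangle)
  also have "\<dots> = (\<Sum>m\<le>N. \<Sum>n\<le>N. if m \<le> n then cnj (a m) * a n * h (n - m) else 0)"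
    by (intro sum.cong refl) auto
  finally show ?thesis .
qed

text \<open>
  The value at w of the k-fold backward shift of the polynomial: its coefficients are moved down by
  k places and the first k of them are dropped.
\<close>

definition backshift :: "nat \<Rightarrow> (nat \<Rightarrow> complex) \<Rightarrow> complex \<Rightarrow> nat \<Rightarrow> complex" where
  "backshift N a w k = (\<Sum>n\<le>N. if k \<le> n then a n * w^(n - k) else 0)"

lemma backshift_step:
  assumes "k \<le> N" shows "backshift N a w k = a k + w * backshift N a w (Suc k)"
proof -
  have "backshift N a w k = (\<Sum>n\<le>N. (if n = k then a n else 0) + w * (if Suc k \<le> n then a n * w^(n - Suc k) else 0))"
    unfolding backshift_def
  proof (intro sum.cong refl)
    fix n
    consider "n < k" | "n = k" | j where "n = Suc k + j" by (metis less_imp_Suc_add linorder_neqE_nat add_Suc)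
    then show "(if k \<le> n then a n * w^(n - k) else 0) = (if n = k then a n else 0) + w * (if Suc k \<le> n then a n * w^(n - Suc k) else 0)"
      by cases auto
  qed
  also have "\<dots> = a k + w * backshift N a w (Suc k)"
    using assms by (simp add: sum.distrib backshift_def sum_distrib_left)
  finally show ?thesis .
qed

text \<open>
  The harmonic extension of the squared modulus of a polynomial from the unit circle, minus the
  squared modulus: twice the transplanted stress function when \<phi> is a polynomial.
\<close>

definition potential_upto :: "nat \<Rightarrow> (nat \<Rightarrow> complex) \<Rightarrow> complex \<Rightarrow> real" where
  "potential_upto N a w = 2 * Re (proj_upto N a w) - (\<Sum>n\<le>N. (cmod (a n))\<^sup>2) - (cmod (\<Sum>n\<le>N. a n * w^n))\<^sup>2"

text \<open>
  With a(m) = B(m) - w B(m+1), the identity 2 Re (cnj a B) - |a|^2 = |B|^2 - |B - a|^2 turns the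
  first two terms of the potential into the sum of |B(m)|^2 - |w|^2 |B(m+1)|^2 over m \<le> N.  The value
  of the polynomial is B(0) and B(N+1) is 0, so each other |B(m)|^2 is left with the factor
  1 - |w|^2.
\<close>

lemma potential_upto_eq:
  "potential_upto N a w = (1 - (cmod w)\<^sup>2) * (\<Sum>m\<le>N. (cmod (backshift N a w (Suc m)))\<^sup>2)"
proof -
  let ?B = "backshift N a w"
  have "proj_upto N a w = (\<Sum>m\<le>N. \<Sum>n\<le>N. if m \<le> n then cnj (a m) * a n * w^(n - m) else 0)"
    unfolding proj_upto_def by (rule autocorr_upto_sum)
  also have "\<dots> = (\<Sum>m\<le>N. cnj (a m) * ?B m)"
    unfolding backshift_def sum_distrib_left by (intro sum.cong refl) (auto simp: mult_ac)
  finally have P: "proj_upto N a w = (\<Sum>m\<le>N. cnj (a m) * ?B m)" .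
  have pt: "2 * Re (cnj (a m) * ?B m) - (cmod (a m))\<^sup>2 = (cmod (?B m))\<^sup>2 - (cmod w)\<^sup>2 * (cmod (?B (Suc m)))\<^sup>2" if "m \<le> N" for m
  proof -
    have e: "?B m - a m = w * ?B (Suc m)" using backshift_step[OF that, of a w] by simp
    have "2 * Re (cnj (a m) * ?B m) - (cmod (a m))\<^sup>2 = (cmod (?B m))\<^sup>2 - (cmod (?B m - a m))\<^sup>2"
      unfolding cmod_power2 by (simp add: power2_eq_square algebra_simps)
    then show ?thesis unfolding e by (simp add: norm_mult power_mult_distrib)
  qed
  have B0: "?B 0 = (\<Sum>n\<le>N. a n * w^n)" by (simp add: backshift_def)
  have BN: "?B (Suc N) = 0" by (simp add: backshift_def)
  have "2 * Re (proj_upto N a w) - (\<Sum>n\<le>N. (cmod (a n))\<^sup>2) = (\<Sum>m\<le>N. 2 * Re (cnj (a m) * ?B m) - (cmod (a m))\<^sup>2)"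
    unfolding P Re_sum by (simp add: sum_subtractf sum_distrib_left)
  also have "\<dots> = (\<Sum>m\<le>N. (cmod (?B m))\<^sup>2 - (cmod w)\<^sup>2 * (cmod (?B (Suc m)))\<^sup>2)"
    by (intro sum.cong refl pt) simp
  also have "\<dots> = (\<Sum>m\<le>N. (cmod (?B m))\<^sup>2) - (cmod w)\<^sup>2 * (\<Sum>m\<le>N. (cmod (?B (Suc m)))\<^sup>2)"
    by (simp add: sum_subtractf sum_distrib_left)
  also have "(\<Sum>m\<le>N. (cmod (?B m))\<^sup>2) = (cmod (?B 0))\<^sup>2 + (\<Sum>m\<le>N. (cmod (?B (Suc m)))\<^sup>2)"
    using sum.atMost_Suc_shift[of "\<lambda>m. (cmod (?B m))\<^sup>2" N] BN by simp
  finally show ?thesis unfolding potential_upto_def B0 by (simp add: algebra_simps)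
qed

text \<open>
  Cauchy-Schwarz against the geometric series.
\<close>

lemma backshift_bound:
  assumes w: "cmod w < 1"
  shows "(1 - (cmod w)\<^sup>2) * (cmod (backshift N a w k))\<^sup>2 \<le> (\<Sum>n\<le>N. if k \<le> n then (cmod (a n))\<^sup>2 else 0)"
proof -
  let ?I = "{n\<in>{..N}. k \<le> n}"
  have w2: "(cmod w)\<^sup>2 < 1" using w by (simp add: power_less_one_iff abs_square_less_1)
  have "backshift N a w k = (\<Sum>n\<in>?I. a n * w^(n-k))"
    unfolding backshift_def by (rule sum.inter_filter[symmetric]) simp
  then have "cmod (backshift N a w k) \<le> (\<Sum>n\<in>?I. cmod (a n) * cmod w ^ (n-k))"
    using norm_sum[of "\<lambda>n. a n * w^(n-k)" ?I] by (simp add: norm_mult norm_power)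
  then have "(cmod (backshift N a w k))\<^sup>2 \<le> (\<Sum>n\<in>?I. cmod (a n) * cmod w ^ (n-k))\<^sup>2"
    by (intro power_mono) auto
  also have "\<dots> \<le> (\<Sum>n\<in>?I. (cmod (a n))\<^sup>2) * (\<Sum>n\<in>?I. (cmod w ^ (n-k))\<^sup>2)"
    by (rule Cauchy_Schwarz_ineq_sum)
  also have "\<dots> \<le> (\<Sum>n\<in>?I. (cmod (a n))\<^sup>2) * (1 / (1 - (cmod w)\<^sup>2))"
  proof (intro mult_left_mono sum_nonneg)
    have "(\<Sum>n\<in>?I. (cmod w ^ (n-k))\<^sup>2) = (\<Sum>j\<in>(\<lambda>n. n - k) ` ?I. ((cmod w)\<^sup>2) ^ j)"
      by (subst sum.reindex) (auto simp: inj_on_def power_commutes simp flip: power_mult intro!: sum.cong, simp add: mult.commute)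
    also have "\<dots> \<le> (\<Sum>j. ((cmod w)\<^sup>2) ^ j)"
      using w2 by (intro sum_le_suminf summable_geometric) auto
    also have "\<dots> = 1 / (1 - (cmod w)\<^sup>2)" using w2 by (intro suminf_geometric) auto
    finally show "(\<Sum>n\<in>?I. (cmod w ^ (n-k))\<^sup>2) \<le> 1 / (1 - (cmod w)\<^sup>2)" .
  qed auto
  finally have "(1 - (cmod w)\<^sup>2) * (cmod (backshift N a w k))\<^sup>2 \<le> (1 - (cmod w)\<^sup>2) * ((\<Sum>n\<in>?I. (cmod (a n))\<^sup>2) * (1 / (1 - (cmod w)\<^sup>2)))"
    using w2 by (intro mult_left_mono) auto
  also have "\<dots> = (\<Sum>n\<in>?I. (cmod (a n))\<^sup>2)" using w2 by simp
  also have "\<dots> = (\<Sum>n\<le>N. if k \<le> n then (cmod (a n))\<^sup>2 else 0)"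
    by (rule sum.inter_filter) simp
  finally show ?thesis .
qed

text \<open>
  Summing \<open>backshift_bound\<close> over k counts |a(n)|^2 once for each of the shifts by 1, ..., n places.  The
  bound does not depend on w, although 1 - |w|^2 can be small.
\<close>

lemma potential_upto_le:
  assumes w: "cmod w < 1"
  shows "potential_upto N a w \<le> (\<Sum>n\<le>N. real n * (cmod (a n))\<^sup>2)"
proof -
  have "potential_upto N a w \<le> (\<Sum>m\<le>N. \<Sum>n\<le>N. if Suc m \<le> n then (cmod (a n))\<^sup>2 else 0)"
    unfolding potential_upto_eq sum_distrib_left by (intro sum_mono backshift_bound w)
  also have "\<dots> = (\<Sum>n\<le>N. \<Sum>m\<le>N. if Suc m \<le> n then (cmod (a n))\<^sup>2 else 0)" by (rule sum.swap)
  also have "\<dots> = (\<Sum>n\<le>N. real n * (cmod (a n))\<^sup>2)"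
  proof (intro sum.cong refl)
    fix n assume "n \<in> {..N}"
    then have "{m\<in>{..N}. Suc m \<le> n} = {..<n}" by auto
    then show "(\<Sum>m\<le>N. if Suc m \<le> n then (cmod (a n))\<^sup>2 else 0) = real n * (cmod (a n))\<^sup>2"
      by (subst sum.inter_filter[symmetric]) auto
  qed
  finally show ?thesis .
qed

text \<open>
  The square root of the potential is a seminorm in the coefficients.  Those up to M contribute a
  bounded multiple of 1 - |w|^2, and the others are controlled by \<open>potential_upto_le\<close>.
\<close>

lemma potential_upto_split:
  assumes w: "cmod w < 1" and "M \<le> N"
  shows "potential_upto N a w \<le> 2 * ((1 - (cmod w)\<^sup>2) * (real (Suc M) * (\<Sum>n\<le>M. cmod (a n))\<^sup>2)) 
            + 2 * (\<Sum>n\<le>N. if M < n then real n * (cmod (a n))\<^sup>2 else 0)"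
proof -
  define h where "h n = (if n \<le> M then a n else 0)" for n
  define t where "t n = (if M < n then a n else 0)" for n
  have w2: "(cmod w)\<^sup>2 < 1" using w by (simp add: power_less_one_iff abs_square_less_1)
  have lin: "backshift N a w k = backshift N h w k + backshift N t w k" for k
    unfolding backshift_def h_def t_def sum.distrib[symmetric] by (intro sum.cong refl) auto
  have "potential_upto N a w \<le> (1 - (cmod w)\<^sup>2) * (\<Sum>m\<le>N. 2 * (cmod (backshift N h w (Suc m)))\<^sup>2 + 2 * (cmod (backshift N t w (Suc m)))\<^sup>2)"
    unfolding potential_upto_eq lin using w2 by (intro mult_left_mono sum_mono cmod_add_square_le) auto
  also have "\<dots> = 2 * ((1 - (cmod w)\<^sup>2) * (\<Sum>m\<le>N. (cmod (backshift N h w (Suc m)))\<^sup>2)) + 2 * potential_upto N t w"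
    unfolding potential_upto_eq by (simp add: sum.distrib sum_distrib_left[symmetric] algebra_simps)
  also have "potential_upto N t w \<le> (\<Sum>n\<le>N. if M < n then real n * (cmod (a n))\<^sup>2 else 0)"
    using potential_upto_le[OF w, of N t] by (rule order_trans) (intro sum_mono, simp add: t_def)
  also have "(\<Sum>m\<le>N. (cmod (backshift N h w (Suc m)))\<^sup>2) \<le> real (Suc M) * (\<Sum>n\<le>M. cmod (a n))\<^sup>2"
  proof -
    have b: "cmod (backshift N h w k) \<le> (\<Sum>n\<le>M. cmod (a n))" for k
    proof -
      have "cmod (backshift N h w k) \<le> (\<Sum>n\<le>N. cmod (if k \<le> n then h n * w^(n-k) else 0))"
        unfolding backshift_def by (rule norm_sum)
      also have "\<dots> \<le> (\<Sum>n\<le>N. if n \<le> M then cmod (a n) else 0)"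
      proof (intro sum_mono)
        fix n
        have "cmod (a n) * cmod w ^ (n-k) \<le> cmod (a n) * 1" 
          using w by (intro mult_left_mono power_le_one) auto
        then show "cmod (if k \<le> n then h n * w^(n-k) else 0) \<le> (if n \<le> M then cmod (a n) else 0)"
          by (simp add: h_def norm_mult norm_power)
      qed
      also have "\<dots> = (\<Sum>n\<le>M. cmod (a n))"
        using \<open>M \<le> N\<close> by (subst sum.inter_filter[symmetric]) (auto intro!: sum.cong)
      finally show ?thesis .
    qed
    have z: "backshift N h w k = 0" if "M < k" for k
      using that by (auto simp: backshift_def h_def intro!: sum.neutral)
    have "(\<Sum>m\<le>N. (cmod (backshift N h w (Suc m)))\<^sup>2) = (\<Sum>m\<le>M. (cmod (backshift N h w (Suc m)))\<^sup>2)"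
      using \<open>M \<le> N\<close> z by (intro sum.mono_neutral_right) auto
    also have "\<dots> \<le> (\<Sum>m\<le>M. (\<Sum>n\<le>M. cmod (a n))\<^sup>2)"
      by (intro sum_mono power_mono b) auto
    finally show ?thesis by simp
  qed
  finally show ?thesis using w2 by (simp add: mult_left_mono)
qed

definition potential :: "(nat \<Rightarrow> complex) \<Rightarrow> complex \<Rightarrow> real" where
  "potential a w = 2 * Re (proj_series a w) - (\<Sum>n. (cmod (a n))\<^sup>2) - (cmod (\<Sum>n. a n * w^n))\<^sup>2"

lemma summable_square_of_weighted:
  assumes "summable (\<lambda>n. real n * (cmod (a n))\<^sup>2)"
  shows "summable (\<lambda>n. (cmod (a n))\<^sup>2)"
proof (rule summable_comparison_test'[OF assms, of 1])
  fix n :: nat assume "1 \<le> n"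
  then show "norm ((cmod (a n))\<^sup>2) \<le> real n * (cmod (a n))\<^sup>2"
    using mult_right_mono[of 1 "real n" "(cmod (a n))\<^sup>2"] by simp
qed

lemma potential_bounds:
  assumes s: "summable (\<lambda>n. real n * (cmod (a n))\<^sup>2)" and w: "cmod w < 1" and p: "summable (\<lambda>n. a n * w^n)"
  shows potential_nonneg: "0 \<le> potential a w"
    and potential_le: "potential a w \<le> 2 * ((1 - (cmod w)\<^sup>2) * (real (Suc M) * (\<Sum>n\<le>M. cmod (a n))\<^sup>2)) 
            + 2 * ((\<Sum>n. real n * (cmod (a n))\<^sup>2) - (\<Sum>n\<le>M. real n * (cmod (a n))\<^sup>2))"
      (is "_ \<le> ?R")
proof -
  note s2 = summable_square_of_weighted[OF s]
  have lim: "(\<lambda>N. potential_upto N a w) \<longlonglongrightarrow> potential a w"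
    unfolding potential_def potential_upto_def
    by (intro tendsto_diff tendsto_mult tendsto_const tendsto_Re tendsto_power tendsto_norm proj_upto_tendsto[OF s2 w]
        summable_LIMSEQ' s2 p)
  have w2: "(cmod w)\<^sup>2 \<le> 1" using w by (simp add: power_le_one)
  show "0 \<le> potential a w"
    using w2 by (intro LIMSEQ_le_const[OF lim]) (auto simp: potential_upto_eq sum_nonneg)
  show "potential a w \<le> ?R"
  proof (rule LIMSEQ_le_const2[OF lim], intro exI allI impI)
    fix N assume N: "M \<le> N"
    let ?f = "\<lambda>n. real n * (cmod (a n))\<^sup>2"
    have "(\<Sum>n\<le>N. ?f n) = (\<Sum>n\<le>N. (if n \<le> M then ?f n else 0) + (if M < n then ?f n else 0))"
      by (intro sum.cong) auto
    also have "\<dots> = (\<Sum>n\<le>N. if n \<le> M then ?f n else 0) + (\<Sum>n\<le>N. if M < n then ?f n else 0)"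
      by (rule sum.distrib)
    also have "(\<Sum>n\<le>N. if n \<le> M then ?f n else 0) = (\<Sum>n\<le>M. ?f n)"
      using N by (subst sum.inter_filter[symmetric]) (auto intro!: sum.cong)
    finally have "(\<Sum>n\<le>N. if M < n then ?f n else 0) = (\<Sum>n\<le>N. ?f n) - (\<Sum>n\<le>M. ?f n)" by simp
    also have "(\<Sum>n\<le>N. ?f n) \<le> (\<Sum>n. ?f n)" by (rule sum_le_suminf[OF s]) auto
    finally show "potential_upto N a w \<le> ?R" using potential_upto_split[OF w N, of a] by simp
  qed
qed

text \<open>
  In \<open>potential_le\<close>, choose M first to make the tail small, and then w close to the circle.
\<close>

lemma potential_vanishes_at_circle:
  assumes s: "summable (\<lambda>n. real n * (cmod (a n))\<^sup>2)" and p: "\<And>w. cmod w < 1 \<Longrightarrow> summable (\<lambda>n. a n * w^n)"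
    and e: "e > 0"
  obtains r where "r < 1" "\<And>w. r < cmod w \<Longrightarrow> cmod w < 1 \<Longrightarrow> potential a w < e"
proof -
  let ?f = "\<lambda>n. real n * (cmod (a n))\<^sup>2"
  have "(\<lambda>M. \<Sum>n\<le>M. ?f n) \<longlonglongrightarrow> (\<Sum>n. ?f n)" by (rule summable_LIMSEQ'[OF s])
  then have "\<forall>\<^sub>F M in sequentially. dist (\<Sum>n\<le>M. ?f n) (\<Sum>n. ?f n) < e / 4" using e by (intro tendstoD) auto
  then obtain M where "\<bar>(\<Sum>n\<le>M. ?f n) - (\<Sum>n. ?f n)\<bar> < e / 4"
    by (auto simp: dist_real_def eventually_sequentially)
  then have M: "(\<Sum>n. ?f n) - (\<Sum>n\<le>M. ?f n) < e / 4" by linarith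
  define K where "K = real (Suc M) * (\<Sum>n\<le>M. cmod (a n))\<^sup>2"
  have K: "K \<ge> 0" by (simp add: K_def)
  \<comment> \<open>ensures 2 (1 - |w|^2) K \<le> 4 (1 - |w|) K \<le> e / 2; the tail contributes less than the other half\<close>
  define r where "r = 1 - e / (8 * (K + 1))"
  have "r < 1" using e K by (simp add: r_def)
  moreover have "potential a w < e" if "r < cmod w" "cmod w < 1" for w
  proof -
    have "1 - (cmod w)\<^sup>2 = (1 - cmod w) * (1 + cmod w)" by (simp add: power2_eq_square algebra_simps)
    also have "\<dots> \<le> (1 - cmod w) * 2" using that by (intro mult_left_mono) auto
    also have "\<dots> \<le> 2 * (e / (8 * (K + 1)))" using that by (simp add: r_def)
    finally have "(1 - (cmod w)\<^sup>2) * K \<le> 2 * (e / (8 * (K + 1))) * K" using K by (rule mult_right_mono)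
    also have "\<dots> \<le> e / 4" using e K by (simp add: field_simps)
    finally have "(1 - (cmod w)\<^sup>2) * K \<le> e / 4" .
    then have "2 * ((1 - (cmod w)\<^sup>2) * K) \<le> e / 2" by simp
    moreover have "2 * ((\<Sum>n. ?f n) - (\<Sum>n\<le>M. ?f n)) < e / 2" using M by simp
    ultimately have "2 * ((1 - (cmod w)\<^sup>2) * K) + 2 * ((\<Sum>n. ?f n) - (\<Sum>n\<le>M. ?f n)) < e / 2 + e / 2"
      by (rule add_le_less_mono)
    then show ?thesis using le_less_trans[OF potential_le[OF s that(2) p[OF that(2)], of M]] by (simp add: K_def)
  qed
  ultimately show ?thesis using that by blast
qed

section \<open>The square norm of the defect\<close>

text \<open>
  The monomial n cnj w^m w^(n-1) minus its projection to the analytic square integrable functions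
  on the disc, which is (n-m) w^(n-m-1) for n > m and 0 otherwise.  Truncated subtraction
  makes the second summand vanish in the latter case.
\<close>

definition defect_term :: "nat \<Rightarrow> nat \<Rightarrow> complex \<Rightarrow> complex" where
  "defect_term m n w = of_nat n * (cnj w^m * w^(n-1)) - of_nat (n-m) * w^(n-m-1)"

definition defect_upto :: "nat \<Rightarrow> (nat \<Rightarrow> complex) \<Rightarrow> complex \<Rightarrow> complex" where
  "defect_upto N a w = cnj (\<Sum>n\<le>N. a n * w^n) * (\<Sum>n\<le>N. a n * (of_nat n * w^(n-1)))
      - (\<Sum>k\<le>N. autocorr_upto N a k * (of_nat k * w^(k-1)))"

lemma defect_upto_eq:
  "defect_upto N a w = (\<Sum>m\<le>N. \<Sum>n\<le>N. cnj (a m) * a n * defect_term m n w)"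
proof -
  have "cnj (\<Sum>n\<le>N. a n * w^n) * (\<Sum>n\<le>N. a n * (of_nat n * w^(n-1)))
      = (\<Sum>m\<le>N. \<Sum>n\<le>N. (cnj (a m) * cnj w^m) * (a n * (of_nat n * w^(n-1))))"
    by (simp add: sum_product cnj_sum)
  then show ?thesis
    unfolding defect_upto_def autocorr_upto_sum
    by (simp only: sum_subtractf[symmetric], intro sum.cong refl) (auto simp: defect_term_def algebra_simps)
qed

text \<open>
  For n > m and n' > m' with the common difference d = n - m = n' - m', the four moments combine to
  \<pi> (n n' / (n + m') - d), which equals \<pi> m m' / (n + m').  For n \<le> m the projections vanish
  and \<pi> n n' / (n + m') remains.
\<close>

lemma defect_term_orthogonality:
  shows "set_integrable lborel (ball 0 1) (\<lambda>w. defect_term m n w * cnj (defect_term m' n' w))"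
    and "(LINT w:ball 0 1|lborel. defect_term m n w * cnj (defect_term m' n' w)) = 
       (if n + m' = n' + m then of_real (pi * (real (min (n*n') (m'*m)) / real (n + m'))) else 0)"
proof -
  define J where "J j k = (if j = k then complex_of_real (pi / real (j+1)) else 0)" for j k :: nat
  define T where "T c j k w = c * (w^j * cnj w^k)" for c :: complex and j k :: nat and w
  have iT: "set_integrable lborel (ball 0 1) (T c j k)" for c j k
    unfolding T_def by (rule set_integrable_mult_right) (rule disc_moment(1), simp)
  have T: "(LINT w:ball 0 1|lborel. T c j k w) = c * J j k" for c j k
    unfolding T_def J_def by (simp add: disc_moment(2)[of 1 j k])
  let ?A = "T (of_nat n * of_nat n') (n-1+m') (m+(n'-1))" and ?B = "T (of_nat n * of_nat (n'-m')) (n-1) (m+(n'-m'-1))"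
  let ?C = "T (of_nat (n-m) * of_nat n') (n-m-1+m') (n'-1)" and ?D = "T (of_nat (n-m) * of_nat (n'-m')) (n-m-1) (n'-m'-1)"
  have e: "defect_term m n w * cnj (defect_term m' n' w) = ?A w - ?B w - ?C w + ?D w" for w
    unfolding defect_term_def T_def by (simp add: power_add algebra_simps)
  show "set_integrable lborel (ball 0 1) (\<lambda>w. defect_term m n w * cnj (defect_term m' n' w))"
    unfolding e by (intro set_integral_add set_integral_diff iT)
  have L: "(LINT w:ball 0 1|lborel. defect_term m n w * cnj (defect_term m' n' w)) = 
     of_nat n * of_nat n' * J (n-1+m') (m+(n'-1)) - of_nat n * of_nat (n'-m') * J (n-1) (m+(n'-m'-1))
     - of_nat (n-m) * of_nat n' * J (n-m-1+m') (n'-1) + of_nat (n-m) * of_nat (n'-m') * J (n-m-1) (n'-m'-1)"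
    unfolding e 
    by (subst set_integral_add set_integral_diff, (intro set_integral_add set_integral_diff iT)+)+ (simp add: T)
  show "(LINT w:ball 0 1|lborel. defect_term m n w * cnj (defect_term m' n' w)) = 
       (if n + m' = n' + m then of_real (pi * (real (min (n*n') (m'*m)) / real (n + m'))) else 0)"
  proof (cases "n = 0 \<or> n' = 0")
    case True
    then show ?thesis unfolding L by auto
  next
    case False
    show ?thesis
    proof (cases "n + m' = n' + m")
      case cond: True
      show ?thesis
      proof (cases "m < n")
        case True
        then obtain d where d: "n = m + Suc d" by (metis add_Suc_right less_imp_Suc_add)
        then have d': "n' = m' + Suc d" using cond by simp
        have le: "m' * m \<le> n * n'" unfolding d d' by (simp add: algebra_simps)
        have r: "real n * real n' / real (n + m') - real (Suc d) = real (m'*m) / real (n+m')"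
        proof -
          have "real n * real n' - real (Suc d) * real (n + m') = real (m'*m)"
            unfolding d d' by (simp add: algebra_simps)
          moreover have "real (n + m') \<noteq> 0" using d by simp
          ultimately show ?thesis by (simp add: field_simps)
        qed
        have "(LINT w:ball 0 1|lborel. defect_term m n w * cnj (defect_term m' n' w)) = 
          of_real (pi * (real n * real n' / real (n + m') - real (Suc d)))"
        proof -
          have j1: "J (n-1+m') (m+(n'-1)) = of_real (pi / real (n+m'))" unfolding d d' J_def by (simp add: add_ac)
          have j2: "J (n-1) (m+(n'-m'-1)) = of_real (pi / real n)" unfolding d d' J_def by (simp add: add_ac)
          have j3: "J (n-m-1+m') (n'-1) = of_real (pi / real n')" unfolding d d' J_def by (simp add: add_ac)
          have j4: "J (n-m-1) (n'-m'-1) = of_real (pi / real (Suc d))" unfolding d d' J_def by (simp add: add_ac)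
          have nd: "n - m = Suc d" "n' - m' = Suc d" by (simp_all add: d d')
          have "(LINT w:ball 0 1|lborel. defect_term m n w * cnj (defect_term m' n' w)) = 
            of_real (real n * real n' * (pi / real (n+m')) - real n * real (Suc d) * (pi / real n)
               - real (Suc d) * real n' * (pi / real n') + real (Suc d) * real (Suc d) * (pi / real (Suc d)))"
            unfolding L j1 j2 j3 j4 unfolding nd
            by (simp only: of_real_mult of_real_diff of_real_add of_real_of_nat_eq)
          also have "real n * real n' * (pi / real (n+m')) - real n * real (Suc d) * (pi / real n)
               - real (Suc d) * real n' * (pi / real n') + real (Suc d) * real (Suc d) * (pi / real (Suc d)) 
              = pi * (real n * real n' / real (n + m') - real (Suc d))"
            using False by (simp add: right_diff_distrib del: of_nat_Suc)
          finally show ?thesis .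
        qed
        then show ?thesis unfolding r using cond le by (simp add: min_absorb2)
      next
        case nlt: False
        then have z: "n - m = 0" "n' - m' = 0" using cond by auto
        have le: "n * n' \<le> m' * m" using z by (metis diff_is_0_eq mult.commute mult_le_mono)
        have "J (n-1+m') (m+(n'-1)) = of_real (pi / real (n+m'))"
        proof -
          have "n - 1 + m' = m + (n' - 1)" "n - 1 + m' + 1 = n + m'" using cond False by auto
          then show ?thesis unfolding J_def by (simp only: simp_thms if_True)
        qed
        then show ?thesis unfolding L z using cond le by (simp add: min_absorb1)
      qed
    next
      case cond: False
      have z1: "J (n-1+m') (m+(n'-1)) = 0" using cond False by (auto simp: J_def)
      have z2: "of_nat (n'-m') * J (n-1) (m+(n'-m'-1)) = 0"
      proof (cases "m' < n'")
        case True
        then have "J (n-1) (m+(n'-m'-1)) = 0" using cond False by (auto simp: J_def)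
        then show ?thesis by (simp only: mult_zero_right)
      qed simp
      have z3: "of_nat (n-m) * J (n-m-1+m') (n'-1) = 0"
      proof (cases "m < n")
        case True
        then have "J (n-m-1+m') (n'-1) = 0" using cond False by (auto simp: J_def)
        then show ?thesis by (simp only: mult_zero_right)
      qed simp
      have z4: "of_nat (n-m) * of_nat (n'-m') * J (n-m-1) (n'-m'-1) = 0"
      proof (cases "m < n \<and> m' < n'")
        case True
        then have "J (n-m-1) (n'-m'-1) = 0" using cond False by (auto simp: J_def)
        then show ?thesis by (simp only: mult_zero_right)
      qed auto
      have "(LINT w:ball 0 1|lborel. defect_term m n w * cnj (defect_term m' n' w)) = 
         of_nat n * of_nat n' * J (n-1+m') (m+(n'-1)) - of_nat n * (of_nat (n'-m') * J (n-1) (m+(n'-m'-1)))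
         - of_nat n' * (of_nat (n-m) * J (n-m-1+m') (n'-1)) + of_nat (n-m) * of_nat (n'-m') * J (n-m-1) (n'-m'-1)"
        unfolding L by (simp only: mult_ac)
      then show ?thesis using cond by (simp only: z1 z2 z3 z4 if_False mult_zero_right diff_0_right add_0_right)
    qed
  qed
qed

text \<open>
  The expansion of the square norm is the quadratic form of \<open>antidiagonal_form_bound\<close> in the
  indices p = n, q = m', r = n' and s = m.  All kernel entries are nonnegative, so that the
  coefficients can be replaced by their moduli.
\<close>

lemma defect_upto_L2_bound:
  shows "set_integrable lborel (ball 0 1) (\<lambda>w. (cmod (defect_upto N a w))\<^sup>2)"
    and "(LINT w:ball 0 1|lborel. (cmod (defect_upto N a w))\<^sup>2) \<le> pi / 2 * (\<Sum>n\<le>N. real n * (cmod (a n))\<^sup>2)\<^sup>2"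
proof -
  let ?A = "{..N}"
  define c where "c p q r s = cnj (a s) * a p * a q * cnj (a r)" for p q r s :: nat
  define E where "E p q r s w = c p q r s * (defect_term s p w * cnj (defect_term q r w))" for p q r s w
  define I where "I p q r s = (if p + q = r + s then real (min (p*r) (q * s)) / real (p + q) else 0)" for p q r s :: nat
  have iE: "set_integrable lborel (ball 0 1) (E p q r s)" for p q r s
    unfolding E_def by (intro set_integrable_mult_right defect_term_orthogonality(1))
  have vE: "(LINT w:ball 0 1|lborel. E p q r s w) = of_real (pi * I p q r s) * c p q r s" for p q r s
    unfolding E_def I_def by (simp add: defect_term_orthogonality(2))
  have Q2: "complex_of_real ((cmod (defect_upto N a w))\<^sup>2) = (\<Sum>s\<in>?A. \<Sum>p\<in>?A. \<Sum>q\<in>?A. \<Sum>r\<in>?A. E p q r s w)" for w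
  proof -
    have "complex_of_real ((cmod (defect_upto N a w))\<^sup>2) = defect_upto N a w * cnj (defect_upto N a w)"
      by (rule complex_norm_square)
    also have "\<dots> = (\<Sum>s\<in>?A. \<Sum>p\<in>?A. cnj (a s) * a p * defect_term s p w) * 
        (\<Sum>q\<in>?A. \<Sum>r\<in>?A. cnj (cnj (a q) * a r * defect_term q r w))"
      unfolding defect_upto_eq by (simp add: cnj_sum)
    also have "\<dots> = (\<Sum>s\<in>?A. \<Sum>p\<in>?A. \<Sum>q\<in>?A. \<Sum>r\<in>?A. (cnj (a s) * a p * defect_term s p w) * cnj (cnj (a q) * a r * defect_term q r w))"
      unfolding sum_distrib_right unfolding sum_distrib_left ..
    also have "\<dots> = (\<Sum>s\<in>?A. \<Sum>p\<in>?A. \<Sum>q\<in>?A. \<Sum>r\<in>?A. E p q r s w)"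
      by (intro sum.cong refl) (simp add: E_def c_def mult_ac)
    finally show ?thesis .
  qed
  have iQ: "set_integrable lborel (ball 0 1) (\<lambda>w. complex_of_real ((cmod (defect_upto N a w))\<^sup>2))"
    unfolding Q2 set_integrable_def scaleR_sum_right
    by (intro Bochner_Integration.integrable_sum) (rule iE[unfolded set_integrable_def])
  show "set_integrable lborel (ball 0 1) (\<lambda>w. (cmod (defect_upto N a w))\<^sup>2)"
    using iQ unfolding set_integrable_def scaleR_complex_of_real complex_of_real_integrable_eq .
  have "complex_of_real (LINT w:ball 0 1|lborel. (cmod (defect_upto N a w))\<^sup>2) = 
     (LINT w:ball 0 1|lborel. complex_of_real ((cmod (defect_upto N a w))\<^sup>2))"
    unfolding set_lebesgue_integral_def scaleR_complex_of_real integral_complex_of_real ..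
  also have "\<dots> = (\<Sum>s\<in>?A. \<Sum>p\<in>?A. \<Sum>q\<in>?A. \<Sum>r\<in>?A. (LINT w:ball 0 1|lborel. E p q r s w))"
    unfolding Q2 set_lebesgue_integral_def scaleR_sum_right
    by (simp only: Bochner_Integration.integral_sum Bochner_Integration.integrable_sum iE[unfolded set_integrable_def])
  finally have val: "complex_of_real (LINT w:ball 0 1|lborel. (cmod (defect_upto N a w))\<^sup>2)
     = (\<Sum>s\<in>?A. \<Sum>p\<in>?A. \<Sum>q\<in>?A. \<Sum>r\<in>?A. of_real (pi * I p q r s) * c p q r s)" unfolding vE .
  have "(LINT w:ball 0 1|lborel. (cmod (defect_upto N a w))\<^sup>2) \<le> cmod (complex_of_real (LINT w:ball 0 1|lborel. (cmod (defect_upto N a w))\<^sup>2))"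
    by simp
  also have "\<dots> \<le> (\<Sum>s\<in>?A. \<Sum>p\<in>?A. \<Sum>q\<in>?A. \<Sum>r\<in>?A. cmod (of_real (pi * I p q r s) * c p q r s))"
    unfolding val by (intro order_trans[OF norm_sum] sum_mono order_refl)
  also have "\<dots> = (\<Sum>s\<in>?A. \<Sum>p\<in>?A. \<Sum>q\<in>?A. \<Sum>r\<in>?A. pi * (if p + q = r + s
            then real (min (p*r) (q * s)) / real (p+q) * (cmod (a p) * cmod (a q) * cmod (a r) * cmod (a s)) else 0))"
    (is "_ = (\<Sum>s\<in>?A. \<Sum>p\<in>?A. \<Sum>q\<in>?A. \<Sum>r\<in>?A. pi * ?F p q r s)")
    by (intro sum.cong refl) (auto simp: I_def c_def norm_mult mult_ac)
  also have "\<dots> = pi * (\<Sum>s\<in>?A. \<Sum>p\<in>?A. \<Sum>q\<in>?A. \<Sum>r\<in>?A. ?F p q r s)"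
    by (simp only: sum_distrib_left)
  also have "(\<Sum>s\<in>?A. \<Sum>p\<in>?A. \<Sum>q\<in>?A. \<Sum>r\<in>?A. ?F p q r s) = (\<Sum>p\<in>?A. \<Sum>s\<in>?A. \<Sum>q\<in>?A. \<Sum>r\<in>?A. ?F p q r s)"
    by (rule sum.swap)
  also have "\<dots> = (\<Sum>p\<in>?A. \<Sum>q\<in>?A. \<Sum>s\<in>?A. \<Sum>r\<in>?A. ?F p q r s)"
    by (intro sum.cong refl sum.swap)
  also have "\<dots> = (\<Sum>p\<in>?A. \<Sum>q\<in>?A. \<Sum>r\<in>?A. \<Sum>s\<in>?A. ?F p q r s)"
    by (rule sum.cong[OF refl], rule sum.cong[OF refl], rule sum.swap)
  also have "\<dots> \<le> (\<Sum>n\<in>?A. real n * (cmod (a n))\<^sup>2)\<^sup>2 / 2"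
    by (rule antidiagonal_form_bound) simp
  finally show "(LINT w:ball 0 1|lborel. (cmod (defect_upto N a w))\<^sup>2) \<le> pi / 2 * (\<Sum>n\<le>N. real n * (cmod (a n))\<^sup>2)\<^sup>2"
    by simp
qed

section \<open>Integration by parts against functions vanishing on the boundary\<close>

text \<open>
  Applied to f this shows that cnj z - f is square integrable; applied to cnj z - f it shows that
  f is.
\<close>

lemma cnj_minus_square_integrable:
  assumes op: "open \<Omega>" and bd: "bounded \<Omega>" and cont: "continuous_on \<Omega> g"
    and g2: "set_integrable lborel \<Omega> (\<lambda>z. (cmod (g z))\<^sup>2)"
  shows "set_integrable lborel \<Omega> (\<lambda>z. (cmod (cnj z - g z))\<^sup>2)"
proof -
  obtain R where R: "\<And>z. z \<in> \<Omega> \<Longrightarrow> cmod z \<le> R" using bd by (auto simp: bounded_iff)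
  have "set_integrable lborel \<Omega> (\<lambda>z. 2 * R\<^sup>2 + 2 * (cmod (g z))\<^sup>2)"
    by (intro set_integral_add(1) set_integrable_mult_right g2
        set_integrable_bounded_continuous[OF op bd, of _ "\<bar>2*R\<^sup>2\<bar>"]) auto
  moreover have "set_borel_measurable borel \<Omega> (\<lambda>z. (cmod (cnj z - g z))\<^sup>2)"
    by (intro set_borel_measurable_continuous_open op continuous_intros cont)
  moreover have "(cmod (cnj z - g z))\<^sup>2 \<le> 2 * R\<^sup>2 + 2 * (cmod (g z))\<^sup>2" if "z \<in> \<Omega>" for z
  proof -
    have "(cmod z)\<^sup>2 \<le> R\<^sup>2" using R[OF that] by (intro power_mono) auto
    then show ?thesis using cmod_add_square_le[of "cnj z" "- g z"] by simp
  qed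
  ultimately show ?thesis
    unfolding set_integrable_def set_borel_measurable_def
    by (elim Bochner_Integration.integrable_bound) (auto simp: indicator_def intro: order_trans[OF _ abs_ge_self])
qed

lemma lborel_integral_translate:
  fixes g :: "complex \<Rightarrow> complex"
  assumes "g \<in> borel_measurable borel"
  shows "(LINT z|lborel. g (z + a)) = (LINT z|lborel. g z)"
    and "integrable lborel (\<lambda>z. g (z + a)) \<longleftrightarrow> integrable lborel g"
proof -
  have d: "distr lborel borel ((+) a) = (lborel :: complex measure)"
    by (rule lborel_distr_plus)
  have "(LINT z|lborel. g z) = (LINT z|distr lborel borel ((+) a). g z)" by (simp add: d)
  also have "\<dots> = (LINT z|lborel. g (z + a))"
    using assms by (subst integral_distr) (auto simp: add.commute)
  finally show "(LINT z|lborel. g (z + a)) = (LINT z|lborel. g z)" ..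
  have "integrable lborel g \<longleftrightarrow> integrable (distr lborel borel ((+) a)) g" by (simp add: d)
  also have "\<dots> \<longleftrightarrow> integrable lborel (\<lambda>z. g (z + a))"
    using assms by (subst integrable_distr_eq) (auto simp: add.commute)
  finally show "integrable lborel (\<lambda>z. g (z + a)) \<longleftrightarrow> integrable lborel g" ..
qed

text \<open>
  Lebesgue measure is translation invariant, so the difference quotients of g have integral 0; the
  Lipschitz bound dominates them.
\<close>

lemma integral_derivative_compact_support:
  fixes g :: "complex \<Rightarrow> complex"
  assumes der: "\<And>z. (g has_derivative g' z) (at z)"
    and B: "\<And>z. onorm (g' z) \<le> B"
    and K: "\<And>z. cmod z \<ge> R \<Longrightarrow> g z = 0"
    and b: "cmod b = 1"
  shows "integrable lborel (\<lambda>z. g' z b)" and "(LINT z|lborel. g' z b) = 0"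
proof -
  have cont: "continuous_on UNIV g"
    using der by (metis has_derivative_continuous_on has_derivative_at_withinI)
  then have gm [measurable]: "g \<in> borel_measurable borel" by (rule borel_measurable_continuous_onI)
  have lip: "cmod (g x - g y) \<le> B * cmod (x - y)" for x y
    using differentiable_bound[of UNIV g g' B x y] der B by (auto intro: has_derivative_at_withinI)
  have B0: "B \<ge> 0" using order_trans[OF onorm_pos_le[OF has_derivative_bounded_linear[OF der[of 0]]] B] .
  define t where "t n = inverse (real (Suc n))" for n
  have t: "0 < t n" "t n \<le> 1" for n by (auto simp: t_def divide_simps)
  have t0: "t \<longlonglongrightarrow> 0" unfolding t_def by (rule LIMSEQ_inverse_real_of_nat)
  define q where "q n z = (g (z + of_real (t n) * b) - g z) /\<^sub>R t n" for n z
  have lim: "(\<lambda>n. q n z) \<longlonglongrightarrow> g' z b" for z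
  proof -
    have bl: "bounded_linear (g' z)" and l: "((\<lambda>h. cmod (g (z + h) - g z - g' z h) / cmod h) \<longlongrightarrow> 0) (at 0)"
      using der[of z] by (auto simp: has_derivative_at)
    have "filterlim (\<lambda>n. of_real (t n) * b) (at 0) sequentially"
      unfolding filterlim_at using t(1) b less_imp_neq[OF t(1)]
      by (auto intro!: tendsto_eq_intros t0 tendsto_of_real)
    from filterlim_compose[OF l this]
    have "(\<lambda>n. cmod (q n z - g' z b)) \<longlonglongrightarrow> 0"
    proof (rule Lim_transform_eventually, intro always_eventually allI)
      fix n
      have "g' z (of_real (t n) * b) = t n *\<^sub>R g' z b"
        using linear_scale[OF bounded_linear.linear[OF bl]] by (simp add: scaleR_conv_of_real)
      then have "q n z - g' z b = (g (z + of_real (t n) * b) - g z - g' z (of_real (t n) * b)) /\<^sub>R t n"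
        using t(1)[of n] by (simp add: q_def scaleR_diff_right)
      then show "cmod (g (z + of_real (t n) * b) - g z - g' z (of_real (t n) * b)) / cmod (of_real (t n) * b)
         = cmod (q n z - g' z b)"
        using t(1)[of n] b by (simp add: norm_mult divide_inverse mult.commute)
    qed
    then show ?thesis using LIM_zero_cancel tendsto_norm_zero_iff by blast
  qed
  define w where "w z = B * indicator (cball 0 (\<bar>R\<bar>+1)) z" for z :: complex
  have dom: "norm (q n z) \<le> w z" for n z
  proof (cases "z \<in> cball 0 (\<bar>R\<bar>+1)")
    case True
    have "cmod (g (z + of_real (t n) * b) - g z) \<le> B * t n"
      using lip[of "z + of_real (t n) * b" z] t[of n] b by (simp add: norm_mult)
    then have "inverse (t n) * cmod (g (z + of_real (t n) * b) - g z) \<le> inverse (t n) * (B * t n)"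
      using t(1)[of n] by (intro mult_left_mono) auto
    then show ?thesis using True t(1)[of n] 
      unfolding q_def w_def norm_scaleR by (simp add: field_simps)
  next
    case False
    then have "cmod z > \<bar>R\<bar>+1" by simp
    moreover have "cmod z \<le> cmod (z + of_real (t n) * b) + t n"
      using norm_triangle_ineq4[of "z + of_real (t n) * b" "of_real (t n) * b"] t[of n] b by (simp add: norm_mult)
    ultimately have "cmod (z + of_real (t n) * b) \<ge> R" "cmod z \<ge> R" using t[of n] by linarith+
    then show ?thesis using K False by (simp add: q_def w_def)
  qed
  have wi: "integrable lborel w"
    unfolding w_def using emeasure_compact_finite[of "cball (0::complex) (\<bar>R\<bar>+1)"]
    by (intro integrable_mult_right integrable_real_indicator) auto
  have gi: "integrable lborel g"
  proof -
    have bd: "bounded (g ` cball 0 \<bar>R\<bar>)"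
      by (intro compact_imp_bounded compact_continuous_image continuous_on_subset[OF cont]) auto
    then obtain C where C: "\<And>z. z \<in> cball 0 \<bar>R\<bar> \<Longrightarrow> cmod (g z) \<le> C"
      unfolding bounded_iff by blast
    have C0: "C \<ge> 0" using C[of 0] by (auto intro: order_trans[OF norm_ge_zero])
    have "norm (g z) \<le> norm (C * indicator (cball 0 \<bar>R\<bar>) z)" for z
      using C[of z] K[of z] C0 by (auto simp: indicator_def)
    moreover have "integrable lborel (\<lambda>z. C * indicator (cball (0::complex) \<bar>R\<bar>) z)"
      using emeasure_compact_finite[of "cball (0::complex) (\<bar>R\<bar>)"]
      by (intro integrable_mult_right integrable_real_indicator) auto
    moreover have "g \<in> borel_measurable lborel" by simp
    ultimately show ?thesis by (metis (no_types, lifting) AE_I2 Bochner_Integration.integrable_bound)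
  qed
  have gm' [measurable]: "(\<lambda>z. g' z b) \<in> borel_measurable borel"
    by (rule borel_measurable_LIMSEQ_metric[OF _ lim]) (simp add: q_def)
  have "(\<lambda>n. LINT z|lborel. q n z) \<longlonglongrightarrow> (LINT z|lborel. g' z b)"
    by (rule integral_dominated_convergence[OF _ _ wi]) (use lim dom in \<open>auto simp: q_def\<close>)
  moreover have "(LINT z|lborel. q n z) = 0" for n
  proof -
    have "(LINT z|lborel. g (z + of_real (t n) * b) - g z) = 0"
      using lborel_integral_translate[OF gm] gi by simp
    then show ?thesis unfolding q_def by simp
  qed
  ultimately show "(LINT z|lborel. g' z b) = 0" by (simp add: LIMSEQ_const_iff)
  show "integrable lborel (\<lambda>z. g' z b)"
  proof (rule Bochner_Integration.integrable_bound[OF wi _ AE_I2])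
    fix z
    have "cmod (g' z b) \<le> w z"
      by (rule LIMSEQ_le_const2[OF tendsto_norm[OF lim]]) (use dom in auto)
    then show "cmod (g' z b) \<le> norm (w z)" by simp
  qed simp
qed

text \<open>
  A continuously differentiable version of the map that shrinks t towards 0 by a constant and
  sends a neighbourhood of 0 to 0: the derivative rises linearly from 0 to 1 while |t| runs from e
  to 2e.
\<close>

definition soft_threshold :: "real \<Rightarrow> real \<Rightarrow> real" where
  "soft_threshold e t = ((max 0 (t - e))\<^sup>2 - (max 0 (t - 2*e))\<^sup>2 - (max 0 (- t - e))\<^sup>2 + (max 0 (- t - 2*e))\<^sup>2) / (2*e)"

definition threshold_deriv :: "real \<Rightarrow> real \<Rightarrow> real" where
  "threshold_deriv e t = (max 0 (t - e) - max 0 (t - 2*e) + max 0 (- t - e) - max 0 (- t - 2*e)) / e"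

lemma has_derivative_pos_part_square: "((\<lambda>t. (max 0 t)\<^sup>2) has_real_derivative 2 * max 0 t) (at t)" 
proof -
  consider "t > 0" | "t < 0" | "t = 0" by linarith
  then show ?thesis
  proof cases
    case 1
    have "((\<lambda>t. t\<^sup>2) has_real_derivative 2 * t) (at t)" by (auto intro!: derivative_eq_intros)
    then show ?thesis using 1 
      by (auto elim!: has_field_derivative_transform_within_open[where S="{0<..}"])
  next
    case 2
    have "((\<lambda>t. 0) has_real_derivative 0) (at t)" by (auto intro!: derivative_eq_intros)
    from has_field_derivative_transform_within_open[OF this, of "{..<0}"] show ?thesis using 2 by simp
  next
    case 3
    have "((\<lambda>h::real. (max 0 h)\<^sup>2 / h) \<longlongrightarrow> 0) (at 0)"
    proof (rule Lim_null_comparison)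
      show "\<forall>\<^sub>F h in at 0. norm ((max 0 h)\<^sup>2 / h) \<le> \<bar>h::real\<bar>"
        by (auto simp: eventually_at_filter max_def power2_eq_square)
      show "((\<lambda>h. \<bar>h::real\<bar>) \<longlongrightarrow> 0) (at 0)" by (auto intro!: tendsto_eq_intros)
    qed
    then show ?thesis using 3 by (simp add: DERIV_def)
  qed
qed

lemma soft_threshold_properties:
  assumes e: "e > 0"
  shows soft_threshold_has_deriv: "(soft_threshold e has_real_derivative threshold_deriv e t) (at t)"
    and threshold_deriv_bounds: "0 \<le> threshold_deriv e t" "threshold_deriv e t \<le> 1"
    and soft_threshold_zero: "\<bar>t\<bar> \<le> e \<Longrightarrow> soft_threshold e t = 0"
    and soft_threshold_close: "\<bar>soft_threshold e t - t\<bar> \<le> 2 * e"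
    and threshold_deriv_cont: "continuous_on UNIV (threshold_deriv e)"
proof -
  have sq: "((\<lambda>t. (max 0 (f t))\<^sup>2) has_real_derivative 2 * max 0 (f t) * c) (at t)"
    if "(f has_real_derivative c) (at t)" for f c
    by (rule DERIV_chain2[OF has_derivative_pos_part_square that])
  have lin: "((\<lambda>t. t - a) has_real_derivative 1) (at t)" "((\<lambda>t. - t - a) has_real_derivative -1) (at t)" for a
    by (auto intro!: derivative_eq_intros)
  have "(soft_threshold e has_real_derivative (2 * max 0 (t - e) * 1 - 2 * max 0 (t - 2*e) * 1 
           - 2 * max 0 (- t - e) * (-1) + 2 * max 0 (- t - 2*e) * (-1)) / (2*e)) (at t)"
    unfolding soft_threshold_def
    by (intro DERIV_cdivide DERIV_add DERIV_diff sq lin)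
  also have "(2 * max 0 (t - e) * 1 - 2 * max 0 (t - 2*e) * 1 
           - 2 * max 0 (- t - e) * (-1) + 2 * max 0 (- t - 2*e) * (-1)) / (2*e) = threshold_deriv e t"
    unfolding threshold_deriv_def using e by (simp add: divide_simps)
  finally show "(soft_threshold e has_real_derivative threshold_deriv e t) (at t)" .
  show "0 \<le> threshold_deriv e t" "threshold_deriv e t \<le> 1"
    using e by (auto simp: threshold_deriv_def divide_simps max_def)
  show "\<bar>t\<bar> \<le> e \<Longrightarrow> soft_threshold e t = 0" using e by (auto simp: soft_threshold_def max_def)
  have pos: "\<bar>soft_threshold e t - t\<bar> \<le> 2 * e" if "t \<ge> 0" for t
  proof -
    consider "t \<le> e" | "e < t" "t \<le> 2*e" | "2*e < t" by linarith
    then show ?thesis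
    proof cases
      case 1 then show ?thesis using that e by (auto simp: soft_threshold_def max_def)
    next
      case 2
      define x where "x = (t-e)\<^sup>2 / (2*e)"
      have "soft_threshold e t = x" using e 2 by (auto simp: soft_threshold_def max_def x_def)
      moreover have "(t-e)\<^sup>2 \<le> (t-e)*e" using 2 by (simp add: power2_eq_square mult_left_mono)
      then have "x \<le> (t - e)/2" unfolding x_def using e by (simp add: divide_simps mult.commute)
      moreover have "0 \<le> x" unfolding x_def using e by simp
      ultimately have "soft_threshold e t - t \<le> 2 * e" "t - soft_threshold e t \<le> 2 * e"
        using \<open>e < t\<close> \<open>t \<le> 2*e\<close> \<open>e > 0\<close> by (auto simp: field_simps)
      then show ?thesis by (simp add: abs_le_iff)
    next
      case 3
      then have "soft_threshold e t = ((t-e)\<^sup>2 - (t-2*e)\<^sup>2) / (2*e)" using e by (auto simp: soft_threshold_def max_def)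
      also have "\<dots> = t - 3/2*e" using e by (simp add: divide_simps power2_eq_square) (simp add: algebra_simps)
      finally show ?thesis using e by simp
    qed
  qed
  have odd: "soft_threshold e (-t) = - soft_threshold e t" unfolding soft_threshold_def minus_divide_left by simp
  show "\<bar>soft_threshold e t - t\<bar> \<le> 2 * e" using pos[of t] pos[of "-t"] odd by (cases "t \<ge> 0") auto
  show "continuous_on UNIV (threshold_deriv e)" unfolding threshold_deriv_def using e by (intro continuous_intros) auto
qed

lemma threshold_deriv_zero: "e > 0 \<Longrightarrow> \<bar>t\<bar> \<le> e \<Longrightarrow> threshold_deriv e t = 0"
  by (auto simp: threshold_deriv_def max_def)

lemma L2_norm_on_Cauchy_Schwarz:
  assumes "set_borel_measurable borel A f" "set_borel_measurable borel A g"
    and f2: "set_integrable lborel A (\<lambda>z. (cmod (f z))\<^sup>2)" and g2: "set_integrable lborel A (\<lambda>z. (cmod (g z))\<^sup>2)"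
  shows "set_integrable lborel A (\<lambda>z. cmod (f z) * cmod (g z))"
    and "(LINT z:A|lborel. cmod (f z) * cmod (g z)) \<le> L2_norm_on A f * L2_norm_on A g"
proof -
  define F where "F z = cmod (indicator A z *\<^sub>R f z)" for z
  define G where "G z = cmod (indicator A z *\<^sub>R g z)" for z
  have m [measurable]: "F \<in> borel_measurable borel" "G \<in> borel_measurable borel"
    using assms(1,2) unfolding set_borel_measurable_def F_def G_def by measurable
  have F2: "indicator A z *\<^sub>R (cmod (f z))\<^sup>2 = (F z)\<^sup>2" and G2: "indicator A z *\<^sub>R (cmod (g z))\<^sup>2 = (G z)\<^sup>2"
    and FG: "indicator A z *\<^sub>R (cmod (f z) * cmod (g z)) = F z * G z" for z
    by (auto simp: F_def G_def indicator_def)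
  have i: "integrable lborel (\<lambda>z. (F z)\<^sup>2)" "integrable lborel (\<lambda>z. (G z)\<^sup>2)"
    using f2 g2 unfolding set_integrable_def F2 G2 by auto
  have pos: "F z \<ge> 0" "G z \<ge> 0" for z by (simp_all add: F_def G_def)
  have le: "F z * G z \<le> ((F z)\<^sup>2 + (G z)\<^sup>2)" for z
    using sum_squares_bound[of "F z" "G z"] mult_nonneg_nonneg[OF pos, of z z] by (simp add: mult.assoc)
  have iFG: "integrable lborel (\<lambda>z. F z * G z)"
  proof (rule Bochner_Integration.integrable_bound[OF Bochner_Integration.integrable_add[OF i] _ AE_I2])
    show "(\<lambda>z. F z * G z) \<in> borel_measurable lborel" by measurable
    show "norm (F z * G z) \<le> norm ((F z)\<^sup>2 + (G z)\<^sup>2)" for z using le[of z] pos by (simp add: abs_mult)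
  qed
  then show "set_integrable lborel A (\<lambda>z. cmod (f z) * cmod (g z))"
    unfolding set_integrable_def FG .
  have nn: "(\<integral>\<^sup>+z. ennreal (F z) * ennreal (G z) \<partial>lborel)\<^sup>2 \<le> 
       (\<integral>\<^sup>+z. (ennreal (F z))\<^sup>2 \<partial>lborel) * (\<integral>\<^sup>+z. (ennreal (G z))\<^sup>2 \<partial>lborel)"
    by (rule Cauchy_Schwarz_nn_integral) auto
  have e: "(\<integral>\<^sup>+z. ennreal (F z) * ennreal (G z) \<partial>lborel) = ennreal (LINT z|lborel. F z * G z)"
      "(\<integral>\<^sup>+z. (ennreal (F z))\<^sup>2 \<partial>lborel) = ennreal (LINT z|lborel. (F z)\<^sup>2)"
      "(\<integral>\<^sup>+z. (ennreal (G z))\<^sup>2 \<partial>lborel) = ennreal (LINT z|lborel. (G z)\<^sup>2)"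
    using nn_integral_eq_integral[OF iFG] nn_integral_eq_integral[OF i(1)] nn_integral_eq_integral[OF i(2)]
    by (simp_all add: pos ennreal_mult' ennreal_power)
  have posI: "0 \<le> (LINT z|lborel. F z * G z)" "0 \<le> (LINT z|lborel. (F z)\<^sup>2)" "0 \<le> (LINT z|lborel. (G z)\<^sup>2)"
    by (auto intro!: integral_nonneg_AE simp: pos)
  have "(LINT z|lborel. F z * G z)\<^sup>2 \<le> (LINT z|lborel. (F z)\<^sup>2) * (LINT z|lborel. (G z)\<^sup>2)"
    using nn posI unfolding e by (simp add: ennreal_mult' [symmetric] ennreal_power)
  then have "sqrt ((LINT z|lborel. F z * G z)\<^sup>2) \<le> sqrt ((LINT z|lborel. (F z)\<^sup>2) * (LINT z|lborel. (G z)\<^sup>2))"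
    by (rule real_sqrt_le_mono)
  then show "(LINT z:A|lborel. cmod (f z) * cmod (g z)) \<le> L2_norm_on A f * L2_norm_on A g"
    unfolding L2_norm_on_def set_lebesgue_integral_def F2 G2 FG using posI by (simp add: real_sqrt_mult)
qed

lemma gradient_complex: "gradient u z = of_real (partial_deriv 1 u z) + \<i> * of_real (partial_deriv \<i> u z)"
  by (simp add: gradient_def Basis_complex_def scaleR_conv_of_real mult.commute)

lemma C2_on_partials_continuous:
  assumes "C2_on \<Omega> u" "b \<in> Basis"
  shows "continuous_on \<Omega> (partial_deriv b u)"
  using assms unfolding C2_on_def by (auto intro: differentiable_imp_continuous_on)

text \<open>
  The product of cnj z - f and the thresholded u vanishes off the compact set where |u| \<ge> e, and
  that set lies in \<Omega> because u is 0 on the boundary.  Hence the product extends by 0 to a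
  Lipschitz function with compact support, and \<open>integral_derivative_compact_support\<close> applies to
  the directions 1 and \<i>.
\<close>

lemma torsion_pairing_bound_threshold:
  assumes op: "open \<Omega>" and bd: "bounded \<Omega>" and st: "is_stress_function \<Omega> u" and f: "f \<in> bergman_space \<Omega>"
    and g2: "set_integrable lborel \<Omega> (\<lambda>z. (cmod (gradient u z))\<^sup>2)" and e: "e > 0"
  shows "set_integrable lborel \<Omega> (\<lambda>z. soft_threshold e (u z))"
    and "2 * \<bar>LINT z:\<Omega>|lborel. soft_threshold e (u z)\<bar> \<le> L2_norm_on \<Omega> (\<lambda>z. cnj z - f z) * L2_norm_on \<Omega> (gradient u)"
proof -
  have cu: "continuous_on (closure \<Omega>) u" and C2: "C2_on \<Omega> u" and u0: "\<And>z. z \<in> frontier \<Omega> \<Longrightarrow> u z = 0"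
    using st by (auto simp: is_stress_function_def)
  have hf: "f holomorphic_on \<Omega>" and f2: "set_integrable lborel \<Omega> (\<lambda>z. (cmod (f z))\<^sup>2)"
    using f by (auto simp: bergman_space_def)
  have cu': "continuous_on \<Omega> u" using cu closure_subset continuous_on_subset by blast
  define D where "D z = frechet_derivative u (at z)" for z
  have D: "(u has_derivative D z) (at z)" if "z \<in> \<Omega>" for z
    using C2 that op unfolding C2_on_def D_def
    by (metis differentiable_on_eq_differentiable_at frechet_derivative_works)
  have Dp: "D z b = partial_deriv b u z" for z b by (simp add: D_def partial_deriv_def)
  have cp: "continuous_on \<Omega> (\<lambda>z. D z 1)" "continuous_on \<Omega> (\<lambda>z. D z \<i>)"
    unfolding Dp using C2_on_partials_continuous[OF C2] by (auto simp: Basis_complex_def)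
  have ct: "continuous_on UNIV (soft_threshold e)"
    using DERIV_continuous_on[of UNIV "soft_threshold e" "threshold_deriv e"] soft_threshold_has_deriv[OF e] by (auto simp: has_field_derivative_at_within)
  have ctu: "continuous_on \<Omega> (\<lambda>z. soft_threshold e (u z))" and ct'u: "continuous_on \<Omega> (\<lambda>z. threshold_deriv e (u z))"
    using continuous_on_compose2[OF ct cu'] continuous_on_compose2[OF threshold_deriv_cont[OF e] cu'] by auto
  have cf: "continuous_on \<Omega> f" and cf': "continuous_on \<Omega> (deriv f)"
    using hf op holomorphic_deriv holomorphic_on_imp_continuous_on by blast+
  have cg: "continuous_on \<Omega> (gradient u)"
    unfolding gradient_complex[abs_def] Dp[symmetric] by (intro continuous_intros cp)
  define g where "g z = (if z \<in> \<Omega> then (cnj z - f z) * of_real (soft_threshold e (u z)) else 0)" for z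
  define g' where "g' z h = (if z \<in> \<Omega> then (cnj h - deriv f z * h) * of_real (soft_threshold e (u z)) + 
       (cnj z - f z) * of_real (threshold_deriv e (u z) * D z h) else 0)" for z h
  define K where "K = {z\<in>closure \<Omega>. e \<le> \<bar>u z\<bar>}"
  have K\<Omega>: "K \<subseteq> \<Omega>" using u0 e op by (force simp: K_def closure_Un_frontier)
  have cK: "compact K"
  proof -
    have "closed ({z\<in>closure \<Omega>. \<bar>u z\<bar> \<in> {e..}})"
      using continuous_closed_preimage[OF continuous_on_rabs[OF cu], of "{e..}"] by (simp add: vimage_def Int_def)
    then show ?thesis using bd unfolding K_def
      by (auto simp: compact_eq_bounded_closed intro: bounded_subset[OF bounded_closure])
  qed
  have outK: "soft_threshold e (u z) = 0" "threshold_deriv e (u z) = 0" if "z \<in> \<Omega>" "z \<notin> K" for z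
    using that closure_subset[of \<Omega>] soft_threshold_zero[OF e] threshold_deriv_zero[OF e] unfolding K_def by auto
  have der: "(g has_derivative g' z) (at z)" for z
  proof (cases "z \<in> \<Omega>")
    case True
    have 1: "(f has_derivative (\<lambda>h. deriv f z * h)) (at z)"
      using hf True op by (auto intro: holomorphic_derivI simp flip: has_field_derivative_def)
    have 2: "((\<lambda>z. soft_threshold e (u z)) has_derivative (\<lambda>h. threshold_deriv e (u z) * D z h)) (at z)"
      using has_derivative_compose[OF D[OF True], of "soft_threshold e" "\<lambda>h. threshold_deriv e (u z) * h"] soft_threshold_has_deriv[OF e]
      by (simp add: has_field_derivative_def)
    have "((\<lambda>z. (cnj z - f z) * of_real (soft_threshold e (u z))) has_derivative g' z) (at z)"
      unfolding g'_def using True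
      by (auto intro!: derivative_eq_intros 1 2 simp: fun_eq_iff algebra_simps)
    then show ?thesis
      by (rule has_derivative_transform_within_open[OF _ op True]) (simp add: g_def)
  next
    case False
    then have z: "z \<in> - K" using K\<Omega> by auto
    have "((\<lambda>z. 0) has_derivative g' z) (at z)" using False by (simp add: g'_def[abs_def])
    then show ?thesis
      by (rule has_derivative_transform_within_open[OF _ _ z]) (use cK outK in \<open>auto simp: g_def compact_imp_closed open_Compl\<close>)
  qed
  \<comment> \<open>a continuous bound for the operator norm of the derivative, used on the compact set K\<close>
  define b where "b z = (1 + cmod (deriv f z)) * \<bar>soft_threshold e (u z)\<bar> + cmod (cnj z - f z) * (\<bar>D z 1\<bar> + \<bar>D z \<i>\<bar>)" for z
  have b0: "b z \<ge> 0" for z by (simp add: b_def)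
  have gb: "cmod (g' z h) \<le> b z * cmod h" if z: "z \<in> \<Omega>" for z h
  proof -
    have lin: "linear (D z)" using D[OF z] has_derivative_linear by blast
    have "D z h = D z (Re h *\<^sub>R 1 + Im h *\<^sub>R \<i>)"
      by (rule arg_cong[of _ _ "D z"]) (simp add: complex_eq_iff)
    also have "\<dots> = Re h * D z 1 + Im h * D z \<i>" by (simp only: linear_add[OF lin] linear_scale[OF lin] real_scaleR_def)
    finally have "\<bar>D z h\<bar> \<le> \<bar>Re h\<bar> * \<bar>D z 1\<bar> + \<bar>Im h\<bar> * \<bar>D z \<i>\<bar>"
      by (metis abs_mult abs_triangle_ineq)
    also have "\<dots> \<le> cmod h * \<bar>D z 1\<bar> + cmod h * \<bar>D z \<i>\<bar>"
      by (intro add_mono mult_right_mono abs_Re_le_cmod abs_Im_le_cmod) auto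
    finally have Dh: "\<bar>D z h\<bar> \<le> (\<bar>D z 1\<bar> + \<bar>D z \<i>\<bar>) * cmod h" by (simp add: algebra_simps)
    have "\<bar>threshold_deriv e (u z) * D z h\<bar> \<le> 1 * \<bar>D z h\<bar>"
      unfolding abs_mult using threshold_deriv_bounds[OF e, of "u z"] by (intro mult_right_mono) auto
    with Dh have 1: "\<bar>threshold_deriv e (u z) * D z h\<bar> \<le> (\<bar>D z 1\<bar> + \<bar>D z \<i>\<bar>) * cmod h" by simp
    have 2: "cmod (cnj h - deriv f z * h) \<le> (1 + cmod (deriv f z)) * cmod h"
      using norm_triangle_ineq4[of "cnj h" "deriv f z * h"] by (simp add: norm_mult algebra_simps)
    have "cmod (g' z h) \<le> cmod (cnj h - deriv f z * h) * \<bar>soft_threshold e (u z)\<bar> + cmod (cnj z - f z) * \<bar>threshold_deriv e (u z) * D z h\<bar>"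
      using z norm_triangle_ineq[of "(cnj h - deriv f z * h) * complex_of_real (soft_threshold e (u z))"
          "(cnj z - f z) * complex_of_real (threshold_deriv e (u z) * D z h)"]
      by (simp add: g'_def norm_mult abs_mult)
    also have "\<dots> \<le> ((1 + cmod (deriv f z)) * cmod h) * \<bar>soft_threshold e (u z)\<bar> + cmod (cnj z - f z) * ((\<bar>D z 1\<bar> + \<bar>D z \<i>\<bar>) * cmod h)"
      by (intro add_mono mult_mono 1 2) auto
    also have "\<dots> = b z * cmod h" by (simp add: b_def algebra_simps)
    finally show ?thesis .
  qed
  have "continuous_on K b" unfolding b_def
    by (rule continuous_on_subset[OF _ K\<Omega>]) (intro continuous_intros cf cf' ctu cp)
  then have "bounded (b ` K)" using cK compact_continuous_image compact_imp_bounded by blast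
  then obtain B where B: "\<And>z. z \<in> K \<Longrightarrow> b z \<le> B" "B \<ge> 0"
    unfolding bounded_pos by (metis abs_le_D1 image_eqI less_eq_real_def real_norm_def)
  have on: "onorm (g' z) \<le> B" for z
  proof (rule onorm_bound[OF B(2)])
    fix h
    show "norm (g' z h) \<le> B * norm h"
    proof (cases "z \<in> K")
      case True
      then show ?thesis using gb[of z h] B(1)[OF True] K\<Omega> 
        by (meson mult_right_mono norm_ge_zero order_trans subsetD)
    next
      case False
      then have "g' z h = 0" using outK by (auto simp: g'_def)
      then show ?thesis using B(2) by simp
    qed
  qed
  obtain R0 where R0: "\<And>z. z \<in> \<Omega> \<Longrightarrow> cmod z \<le> R0" using bd by (auto simp: bounded_iff)
  have van: "cmod z \<ge> R0 + 1 \<Longrightarrow> g z = 0" for z using R0[of z] by (auto simp: g_def)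
  note I = integral_derivative_compact_support[OF der on van]
  have I0: "(LINT z|lborel. g' z 1 + \<i> * g' z \<i>) = 0" "integrable lborel (\<lambda>z. g' z 1 + \<i> * g' z \<i>)"
    using I[where b=1] I[where b=\<i>] by simp_all
  define P where "P z = (cnj z - f z) * of_real (threshold_deriv e (u z)) * gradient u z" for z
  \<comment> \<open>twice the derivative with respect to cnj z; that of f cancels by the Cauchy-Riemann equations\<close>
  have pt: "g' z 1 + \<i> * g' z \<i> = indicator \<Omega> z *\<^sub>R (2 * of_real (soft_threshold e (u z)) + P z)" for z
    unfolding g'_def P_def gradient_complex Dp[symmetric] by (auto simp: algebra_simps)
  have "bounded (u ` closure \<Omega>)" using bd cu by (auto intro!: compact_imp_bounded compact_continuous_image simp: compact_closure)
  then obtain C where C: "\<And>z. z \<in> closure \<Omega> \<Longrightarrow> \<bar>u z\<bar> \<le> C" by (auto simp: bounded_iff)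
  have tb: "\<bar>soft_threshold e (u z)\<bar> \<le> C + 2*e" if "z \<in> \<Omega>" for z
    using soft_threshold_close[OF e, of "u z"] C[of z] that closure_subset[of \<Omega>] by auto
  show it: "set_integrable lborel \<Omega> (\<lambda>z. soft_threshold e (u z))"
    by (rule set_integrable_bounded_continuous[OF op bd ctu, of "C+2*e"]) (use tb in auto)
  have it': "set_integrable lborel \<Omega> (\<lambda>z. complex_of_real (soft_threshold e (u z)))"
    using it unfolding set_integrable_def 
    by (metis (mono_tags, lifting) Bochner_Integration.integrable_cong complex_of_real_integrable_eq of_real_mult real_scaleR_def scaleR_conv_of_real)
  have id: "set_integrable lborel \<Omega> (\<lambda>z. (cmod (cnj z - f z))\<^sup>2)"
    by (rule cnj_minus_square_integrable[OF op bd cf f2])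
  note CS = L2_norm_on_Cauchy_Schwarz[OF _ _ id g2]
  have bm: "set_borel_measurable borel \<Omega> (\<lambda>z. cnj z - f z)" "set_borel_measurable borel \<Omega> (gradient u)"
    by (intro set_borel_measurable_continuous_open op continuous_intros cf cg)+
  have iP: "set_integrable lborel \<Omega> P"
  proof -
    have "set_integrable lborel \<Omega> (\<lambda>z. 2 * complex_of_real (soft_threshold e (u z)))"
      using it' by (rule set_integrable_mult_right)
    then have "integrable lborel (\<lambda>z. (g' z 1 + \<i> * g' z \<i>) - indicator \<Omega> z *\<^sub>R (2 * complex_of_real (soft_threshold e (u z))))"
      unfolding set_integrable_def by (rule Bochner_Integration.integrable_diff[OF I0(2)])
    then show ?thesis unfolding set_integrable_def pt by (simp add: scaleR_add_right)
  qed
  have "0 = (LINT z:\<Omega>|lborel. 2 * complex_of_real (soft_threshold e (u z)) + P z)"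
    using I0(1) unfolding pt set_lebesgue_integral_def by simp
  also have "\<dots> = 2 * (LINT z:\<Omega>|lborel. complex_of_real (soft_threshold e (u z))) + (LINT z:\<Omega>|lborel. P z)"
    using it' iP by (subst set_integral_add) auto
  also have "(LINT z:\<Omega>|lborel. complex_of_real (soft_threshold e (u z))) = of_real (LINT z:\<Omega>|lborel. soft_threshold e (u z))"
    unfolding set_lebesgue_integral_def integral_complex_of_real[symmetric] by (simp add: scaleR_conv_of_real)
  finally have "cmod (2 * of_real (LINT z:\<Omega>|lborel. soft_threshold e (u z))) = cmod (LINT z:\<Omega>|lborel. P z)"
    by (metis add.commute add_eq_0_iff norm_minus_cancel)
  then have "2 * \<bar>LINT z:\<Omega>|lborel. soft_threshold e (u z)\<bar> = cmod (LINT z:\<Omega>|lborel. P z)" by (simp add: norm_mult)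
  also have "\<dots> \<le> (LINT z:\<Omega>|lborel. cmod (P z))" 
    using set_integral_norm_bound[OF iP] .
  also have "\<dots> \<le> (LINT z:\<Omega>|lborel. cmod (cnj z - f z) * cmod (gradient u z))"
  proof (rule set_integral_mono[OF set_integrable_norm[OF iP] CS(1)[OF bm]])
    fix z
    have "cmod (P z) = \<bar>threshold_deriv e (u z)\<bar> * (cmod (cnj z - f z) * cmod (gradient u z))"
      by (simp add: P_def norm_mult)
    also have "\<dots> \<le> 1 * (cmod (cnj z - f z) * cmod (gradient u z))"
      using threshold_deriv_bounds[OF e, of "u z"] by (intro mult_right_mono) auto
    finally show "cmod (P z) \<le> cmod (cnj z - f z) * cmod (gradient u z)" by simp
  qed
  also have "\<dots> \<le> L2_norm_on \<Omega> (\<lambda>z. cnj z - f z) * L2_norm_on \<Omega> (gradient u)"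
    by (rule CS(2)[OF bm])
  finally show "2 * \<bar>LINT z:\<Omega>|lborel. soft_threshold e (u z)\<bar> \<le> L2_norm_on \<Omega> (\<lambda>z. cnj z - f z) * L2_norm_on \<Omega> (gradient u)" .
qed

text \<open>
  Let the threshold e tend to 0: it changes the integral of u by at most 2 e times the area.
\<close>

lemma torsion_pairing_bound:
  assumes op: "open \<Omega>" and bd: "bounded \<Omega>" and st: "is_stress_function \<Omega> u" and f: "f \<in> bergman_space \<Omega>"
    and g2: "set_integrable lborel \<Omega> (\<lambda>z. (cmod (gradient u z))\<^sup>2)"
  shows "2 * \<bar>LINT z:\<Omega>|lborel. u z\<bar> \<le> L2_norm_on \<Omega> (\<lambda>z. cnj z - f z) * L2_norm_on \<Omega> (gradient u)"
    (is "_ \<le> ?P")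
proof (rule field_le_epsilon)
  fix d :: real assume d: "d > 0"
  define A where "A = measure lborel \<Omega>"
  have A0: "A \<ge> 0" by (simp add: A_def)
  define e where "e = d / (4 * (A + 1))"
  have e: "e > 0" using d A0 by (simp add: e_def)
  have cu: "continuous_on (closure \<Omega>) u" using st by (auto simp: is_stress_function_def)
  have "bounded (u ` closure \<Omega>)" using bd cu by (auto intro!: compact_imp_bounded compact_continuous_image simp: compact_closure)
  then obtain C where C: "\<And>z. z \<in> closure \<Omega> \<Longrightarrow> \<bar>u z\<bar> \<le> C" by (auto simp: bounded_iff)
  have iu: "set_integrable lborel \<Omega> u"
    by (rule set_integrable_bounded_continuous[OF op bd, of _ C])
       (use cu C closure_subset[of \<Omega>] in \<open>auto intro: continuous_on_subset\<close>)
  \<comment> \<open>the threshold e is chosen so that the error 4 e A is at most d\<close>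
  note T = torsion_pairing_bound_threshold[OF assms e]
  have fin: "emeasure lborel \<Omega> < \<infinity>" using emeasure_bounded_finite[OF bd] by simp
  then have ic: "set_integrable lborel \<Omega> (\<lambda>z. 2 * e)"
    using op unfolding set_integrable_def by (intro integrable_scaleR_left integrable_real_indicator) auto
  have "\<bar>(LINT z:\<Omega>|lborel. u z) - (LINT z:\<Omega>|lborel. soft_threshold e (u z))\<bar> = \<bar>LINT z:\<Omega>|lborel. u z - soft_threshold e (u z)\<bar>"
    by (subst set_integral_diff[OF iu T(1)]) simp
  also have "\<dots> \<le> (LINT z:\<Omega>|lborel. \<bar>u z - soft_threshold e (u z)\<bar>)"
    using set_integral_norm_bound[OF set_integral_diff(1)[OF iu T(1)]] by simp
  also have "\<dots> \<le> (LINT z:\<Omega>|lborel. 2 * e)"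
    using set_integrable_norm[OF set_integral_diff(1)[OF iu T(1)]] soft_threshold_close[OF e] 
    by (intro set_integral_mono ic) (auto simp: abs_minus_commute)
  also have "\<dots> = A * (2 * e)" using op fin by (simp add: A_def set_lebesgue_integral_def)
  finally have "\<bar>LINT z:\<Omega>|lborel. u z\<bar> \<le> \<bar>LINT z:\<Omega>|lborel. soft_threshold e (u z)\<bar> + 2 * e * A" by (simp add: mult.commute mult.left_commute)
  then have "2 * \<bar>LINT z:\<Omega>|lborel. u z\<bar> \<le> ?P + 4 * e * A" using T(2) by simp
  also have "4 * e * A \<le> d" using A0 d by (simp add: e_def field_simps)
  finally show "2 * \<bar>LINT z:\<Omega>|lborel. u z\<bar> \<le> ?P + d" by simp
qed

section \<open>Transplantation from the disc\<close>

lemma real_part_affine_derivative: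
  fixes h :: "complex \<Rightarrow> complex"
  assumes "(h has_field_derivative d) (at z)"
  shows "((\<lambda>z. Re (h z * b) - z \<bullet> b) has_derivative (\<lambda>v. Re (d * v * b) - v \<bullet> b)) (at z)"
proof -
  have "(h has_derivative (\<lambda>v. d * v)) (at z)" using assms by (simp add: has_field_derivative_def)
  then show ?thesis
    by (auto intro!: derivative_eq_intros)
qed

text \<open>
  The real part of an analytic function is harmonic, and the Laplacian of |z|^2 / 2 is 2.
\<close>

lemma C2_real_part_minus_quadratic:
  fixes h :: "complex \<Rightarrow> complex"
  assumes op: "open \<Omega>" and hol: "h holomorphic_on \<Omega>" and u: "\<And>z. z \<in> \<Omega> \<Longrightarrow> u z = Re (h z) - c - (cmod z)\<^sup>2 / 2"
  shows "C2_on \<Omega> u" and "\<And>z. z \<in> \<Omega> \<Longrightarrow> laplacian u z = - 2"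
proof -
  have hd: "(h has_field_derivative deriv h z) (at z)" and hdd: "(deriv h has_field_derivative deriv (deriv h) z) (at z)" 
    if "z \<in> \<Omega>" for z
    using that hol op holomorphic_deriv[OF hol op] by (auto intro: holomorphic_derivI)
  have du: "(u has_derivative (\<lambda>v. Re (deriv h z * v) - z \<bullet> v)) (at z)" if z: "z \<in> \<Omega>" for z
  proof -
    have "(h has_derivative (\<lambda>v. deriv h z * v)) (at z)" using hd[OF z] by (simp add: has_field_derivative_def)
    then have "((\<lambda>z. Re (h z) - c - (z \<bullet> z) / 2) has_derivative (\<lambda>v. Re (deriv h z * v) - z \<bullet> v)) (at z)"
      by (auto intro!: derivative_eq_intros simp: inner_commute)
    then show ?thesis
      by (rule has_derivative_transform_within_open[OF _ op z]) (simp add: u power2_norm_eq_inner)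
  qed
  have p1: "partial_deriv b u z = Re (deriv h z * b) - z \<bullet> b" if "z \<in> \<Omega>" for b z
    using fun_cong[OF frechet_derivative_at[OF du[OF that]], of b] by (simp add: partial_deriv_def)
  have dp: "(partial_deriv b u has_derivative (\<lambda>v. Re (deriv (deriv h) z * v * b) - v \<bullet> b)) (at z)" if z: "z \<in> \<Omega>" for b z
    using real_part_affine_derivative[OF hdd[OF z], of b]
    by (rule has_derivative_transform_within_open[OF _ op z]) (simp add: p1)
  have p2: "partial_deriv c (partial_deriv b u) z = Re (deriv (deriv h) z * c * b) - c \<bullet> b" if "z \<in> \<Omega>" for b c z
    using fun_cong[OF frechet_derivative_at[OF dp[OF that, of b]], of c] by (simp add: partial_deriv_def[of c])
  have c2: "continuous_on \<Omega> (deriv (deriv h))"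
    using hol op holomorphic_deriv holomorphic_on_imp_continuous_on by blast
  have "continuous_on \<Omega> (partial_deriv c (partial_deriv b u))" for b c
  proof -
    have "continuous_on \<Omega> (\<lambda>z. Re (deriv (deriv h) z * c * b) - c \<bullet> b)" by (intro continuous_intros c2)
    then show ?thesis by (rule continuous_on_eq) (simp add: p2)
  qed
  moreover have "u differentiable_on \<Omega>" "partial_deriv b u differentiable_on \<Omega>" for b
    unfolding differentiable_on_eq_differentiable_at[OF op] using du dp differentiableI by blast+
  ultimately show "C2_on \<Omega> u" unfolding C2_on_def by blast
  show "laplacian u z = - 2" if "z \<in> \<Omega>" for z
    using that by (simp add: laplacian_def Basis_complex_def p2)
qed

locale disc_parametrisation =
  fixes \<Omega> :: "complex set" and \<phi> \<psi> :: "complex \<Rightarrow> complex" and a :: "nat \<Rightarrow> complex"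
  assumes op: "open \<Omega>" and bd: "bounded \<Omega>"
    and hol\<phi>: "\<phi> holomorphic_on ball 0 1" and hol\<psi>: "\<psi> holomorphic_on \<Omega>"
    and \<psi>_in: "\<And>z. z \<in> \<Omega> \<Longrightarrow> cmod (\<psi> z) < 1" and \<phi>\<psi>: "\<And>z. z \<in> \<Omega> \<Longrightarrow> \<phi> (\<psi> z) = z"
    and \<phi>_in: "\<And>w. cmod w < 1 \<Longrightarrow> \<phi> w \<in> \<Omega>" and \<psi>\<phi>: "\<And>w. cmod w < 1 \<Longrightarrow> \<psi> (\<phi> w) = w"
    and sums: "\<And>w. cmod w < 1 \<Longrightarrow> (\<lambda>n. a n * w^n) sums \<phi> w"
begin

text \<open>
  The transplanted potential.  Points of \<Omega> near the frontier leave every compact set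
  \<phi>(cball 0 r), so their preimages tend to the unit circle, where the potential vanishes.
\<close>

lemma exists_stress_function:
  assumes s: "summable (\<lambda>n. real n * (cmod (a n))\<^sup>2)"
  shows "\<exists>u. is_stress_function \<Omega> u"
proof -
  define u where "u z = (if z \<in> \<Omega> then potential a (\<psi> z) / 2 else 0)" for z
  note s2 = summable_square_of_weighted[OF s]
  define c where "c = (\<Sum>n. (cmod (a n))\<^sup>2) / 2"
  have "(proj_series a \<circ> \<psi>) holomorphic_on \<Omega>"
    by (rule holomorphic_on_compose_gen[OF hol\<psi> proj_series_holomorphic[OF s2]]) (use \<psi>_in in auto)
  then have hol: "(\<lambda>z. proj_series a (\<psi> z)) holomorphic_on \<Omega>" by (simp add: o_def)
  have uz: "u z = Re (proj_series a (\<psi> z)) - c - (cmod z)\<^sup>2 / 2" if "z \<in> \<Omega>" for z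
    using that sums[OF \<psi>_in[OF that]] \<phi>\<psi>[OF that] unfolding u_def potential_def c_def
    by (simp add: sums_iff diff_divide_distrib)
  note C2 = C2_real_part_minus_quadratic[OF op hol uz]
  have sm: "summable (\<lambda>n. a n * w^n)" if "cmod w < 1" for w using sums[OF that] by (simp add: sums_iff)
  have "continuous_on (closure \<Omega>) u"
    unfolding continuous_on_eq_continuous_within
  proof
    fix z assume z: "z \<in> closure \<Omega>"
    show "continuous (at z within closure \<Omega>) u"
    proof (cases "z \<in> \<Omega>")
      case True
      then have "u differentiable (at z)" using C2(1) op by (auto simp: C2_on_def differentiable_on_eq_differentiable_at)
      from differentiable_imp_continuous_within[OF this] show ?thesis
        by (rule continuous_at_imp_continuous_within)
    next
      case False
      show ?thesis unfolding continuous_within_eps_delta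
      proof (intro allI impI)
        fix e :: real assume e: "e > 0"
        obtain r where r: "r < 1" "\<And>w. r < cmod w \<Longrightarrow> cmod w < 1 \<Longrightarrow> potential a w < e"
          using potential_vanishes_at_circle[OF s sm e] by blast
        have "compact (\<phi> ` cball 0 r)"
          using r by (intro compact_continuous_image continuous_on_subset[OF holomorphic_on_imp_continuous_on[OF hol\<phi>]]) auto
        moreover have "z \<notin> \<phi> ` cball 0 r" using False \<phi>_in r by auto
        ultimately obtain d where d: "d > 0" "ball z d \<subseteq> - (\<phi> ` cball 0 r)"
  
          using open_contains_ball[of "- (\<phi> ` cball 0 r)"] by (meson ComplI compact_imp_closed open_Compl)
        have "dist (u x) (u z) < e" if "dist x z < d" for x
        proof (cases "x \<in> \<Omega>")
          case True
          have "x \<in> ball z d" using that by (simp add: dist_commute)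
          then have "x \<notin> \<phi> ` cball 0 r" using d by blast
          then have "r < cmod (\<psi> x)" using \<phi>\<psi>[OF True] image_eqI[of x \<phi> "\<psi> x" "cball 0 r"] by (force simp: not_le)
          then have "potential a (\<psi> x) < e" using r(2) \<psi>_in[OF True] by blast
          moreover have "0 \<le> potential a (\<psi> x)" using potential_nonneg[OF s \<psi>_in[OF True] sm[OF \<psi>_in[OF True]]] .
          ultimately show ?thesis using True False by (simp add: u_def dist_real_def)
        qed (use False e in \<open>simp add: u_def\<close>)
        then show "\<exists>d>0. \<forall>x\<in>closure \<Omega>. dist x z < d \<longrightarrow> dist (u x) (u z) < e" using d by blast
      qed
    qed
  qed
  moreover have "u z = 0" if "z \<in> frontier \<Omega>" for z
    using that op by (auto simp: u_def frontier_def interior_open)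
  ultimately show ?thesis using C2 unfolding is_stress_function_def by blast
qed

end

context disc_parametrisation
begin

lemma image_disc: "\<phi> ` ball 0 1 = \<Omega>"
  using \<phi>_in \<psi>_in \<phi>\<psi> by (auto simp: image_iff) (metis mem_ball_0)

lemma inj_disc: "inj_on \<phi> (ball 0 1)"
  by (rule inj_on_inverseI[of _ \<psi>]) (simp add: \<psi>\<phi>)

lemma deriv_sums:
  assumes "cmod w < 1"
  shows "(\<lambda>n. a n * (of_nat n * w^(n-1))) sums deriv \<phi> w"
    and "(\<lambda>n. diffs a n * w^n) sums deriv \<phi> w"
proof -
  have sm: "summable (\<lambda>n. a n * w^n)" if "cmod w < 1" for w using sums[OF that] by (simp add: sums_iff)
  have d: "((\<lambda>w. \<Sum>n. a n * w^n) has_field_derivative (\<Sum>n. diffs a n * w^n)) (at w)"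
    by (rule termdiffs_strong'[where K=1, OF sm assms])
  have "(\<phi> has_field_derivative (\<Sum>n. diffs a n * w^n)) (at w)"
    by (rule has_field_derivative_transform_within_open[OF d open_ball[of 0 1]])
       (use assms sums in \<open>auto simp: sums_iff\<close>)
  then have e: "deriv \<phi> w = (\<Sum>n. diffs a n * w^n)" by (rule DERIV_imp_deriv)
  have sd: "summable (\<lambda>n. diffs a n * w^n)"
    by (rule termdiff_converges[where K=1, OF assms sm])
  then show s: "(\<lambda>n. diffs a n * w^n) sums deriv \<phi> w" unfolding e by (rule summable_sums)
  have "diffs a n * w^n = a (Suc n) * (of_nat (Suc n) * w^(Suc n - 1))" for n
    unfolding diffs_def diff_Suc_1 by (rule trans[OF mult.assoc mult.left_commute])
  with s have "(\<lambda>n. a (Suc n) * (of_nat (Suc n) * w^(Suc n - 1))) sums deriv \<phi> w" by (simp only:)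
  then show "(\<lambda>n. a n * (of_nat n * w^(n-1))) sums deriv \<phi> w"
    by (subst (asm) sums_Suc_iff) simp
qed

text \<open>
  The area of \<Omega> is the integral of |\<phi>'|^2 over the disc, to which \<open>bergman_Bessel\<close> applies.
\<close>

lemma area_bound:
  "summable (\<lambda>n. real n * (cmod (a n))\<^sup>2)" "pi * (\<Sum>n. real n * (cmod (a n))\<^sup>2) \<le> measure lborel \<Omega>"
proof -
  have c1: "continuous_on (\<phi> ` ball 0 1) (\<lambda>z. 1::real)" by (rule continuous_on_const)
  note cv = conformal_change_of_variables_real[OF open_ball hol\<phi> inj_disc c1, unfolded image_disc]
  have fin: "emeasure lborel \<Omega> < \<infinity>" using emeasure_bounded_finite[OF bd] by simp
  have i1: "set_integrable lborel \<Omega> (\<lambda>z. 1::real)"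
    by (rule set_integrable_bounded_continuous[OF op bd, of _ 1]) auto
  have v1: "(LINT z:\<Omega>|lborel. (1::real)) = measure lborel \<Omega>"
    using op fin by (simp add: set_lebesgue_integral_def)
  have i2: "set_integrable lborel (ball 0 1) (\<lambda>w. (cmod (deriv \<phi> w))\<^sup>2)" using cv(1) i1 by simp
  have v2: "(LINT w:ball 0 1|lborel. (cmod (deriv \<phi> w))\<^sup>2) = measure lborel \<Omega>" using cv(2) v1 by simp
  have b: "pi * (\<Sum>n\<le>N. real n * (cmod (a n))\<^sup>2) \<le> measure lborel \<Omega>" for N
  proof -
    have "(\<Sum>n\<le>N. (cmod (diffs a n))\<^sup>2 / real (n + 1)) = (\<Sum>n\<le>N. real (Suc n) * (cmod (a (Suc n)))\<^sup>2)"
    proof (intro sum.cong refl)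
      fix n
      have "(cmod (diffs a n))\<^sup>2 = (real (Suc n))\<^sup>2 * (cmod (a (Suc n)))\<^sup>2"
        by (simp only: diffs_def norm_mult norm_of_nat power_mult_distrib)
      then show "(cmod (diffs a n))\<^sup>2 / real (n + 1) = real (Suc n) * (cmod (a (Suc n)))\<^sup>2"
        by (simp add: power2_eq_square)
    qed
    also have "\<dots> = (\<Sum>n\<le>Suc N. real n * (cmod (a n))\<^sup>2)" 
      unfolding sum.atMost_Suc_shift[of "\<lambda>n. real n * (cmod (a n))\<^sup>2" N] by simp
    finally have "pi * (\<Sum>n\<le>Suc N. real n * (cmod (a n))\<^sup>2) \<le> measure lborel \<Omega>"
      using bergman_Bessel[OF deriv_sums(2) i2, of N] v2 by simp
    moreover have "pi * (\<Sum>n\<le>N. real n * (cmod (a n))\<^sup>2) \<le> pi * (\<Sum>n\<le>Suc N. real n * (cmod (a n))\<^sup>2)"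
      by (intro mult_left_mono sum_mono2) auto
    ultimately show ?thesis by linarith
  qed
  have b': "(\<Sum>n\<le>N. real n * (cmod (a n))\<^sup>2) \<le> measure lborel \<Omega> / pi" for N
    using b[of N] by (simp add: field_simps)
  have lt: "(\<Sum>n<N. real n * (cmod (a n))\<^sup>2) \<le> measure lborel \<Omega> / pi" for N
    by (rule order_trans[OF sum_mono2 b'[of N]]) auto
  show s: "summable (\<lambda>n. real n * (cmod (a n))\<^sup>2)"
    by (rule summableI_nonneg_bounded[where x="measure lborel \<Omega> / pi"])
       (auto intro: lt)
  have "(\<Sum>n. real n * (cmod (a n))\<^sup>2) \<le> measure lborel \<Omega> / pi"
    by (rule LIMSEQ_le_const2[OF summable_LIMSEQ'[OF s]]) (use b' in blast)
  then show "pi * (\<Sum>n. real n * (cmod (a n))\<^sup>2) \<le> measure lborel \<Omega>" by (simp add: field_simps)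
qed

text \<open>
  With G = \<open>proj_series a\<close>, the competitor is F = (G \<circ> \<psi>)'.  On the disc, (cnj \<phi> - F \<circ> \<phi>) \<phi>' equals
  cnj \<phi> \<phi>' - G', the pointwise limit of the polynomial defects, and Fatou's lemma carries the
  bound of \<open>defect_upto_L2_bound\<close> over to it.
\<close>

lemma bergman_competitor:
  "\<exists>F \<in> bergman_space \<Omega>. L2_norm_on \<Omega> (\<lambda>z. cnj z - F z) \<le> measure lborel \<Omega> / sqrt (2 * pi)"
proof -
  note s = area_bound(1)
  note s2 = summable_square_of_weighted[OF s]
  define E where "E = (\<Sum>n. real n * (cmod (a n))\<^sup>2)"
  define p where "p = proj_series a"
  have dp: "(p has_field_derivative deriv p w) (at w)" if "cmod w < 1" for w
    using proj_series_deriv(1)[OF s2 that] DERIV_imp_deriv unfolding p_def by metis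
  have holp: "p holomorphic_on ball 0 1" unfolding p_def by (rule proj_series_holomorphic[OF s2])
  have "(p \<circ> \<psi>) holomorphic_on \<Omega>"
    by (rule holomorphic_on_compose_gen[OF hol\<psi> holp]) (use \<psi>_in in auto)
  then have hol: "deriv (p \<circ> \<psi>) holomorphic_on \<Omega>" using op by (rule holomorphic_deriv)
  define F where "F = deriv (p \<circ> \<psi>)"
  have d\<phi>: "(\<phi> has_field_derivative deriv \<phi> w) (at w)" if "cmod w < 1" for w
    using that hol\<phi> by (intro holomorphic_derivI[OF hol\<phi> open_ball]) simp
  have F\<phi>: "F (\<phi> w) * deriv \<phi> w = deriv p w" if w: "cmod w < 1" for w
  proof -
    have "((p \<circ> \<psi>) has_field_derivative F (\<phi> w)) (at (\<phi> w))"
      unfolding F_def using \<open>(p \<circ> \<psi>) holomorphic_on \<Omega>\<close> op \<phi>_in[OF w] by (rule holomorphic_derivI)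
    from DERIV_chain[OF this d\<phi>[OF w]]
    have "((p \<circ> \<psi>) \<circ> \<phi> has_field_derivative F (\<phi> w) * deriv \<phi> w) (at w)" .
    moreover have "((p \<circ> \<psi>) \<circ> \<phi> has_field_derivative deriv p w) (at w)"
      by (rule has_field_derivative_transform_within_open[OF dp[OF w] open_ball[of 0 1]]) (use w \<psi>\<phi> in auto)
    ultimately show ?thesis by (rule DERIV_unique)
  qed
  \<comment> \<open>the defect: the difference of cnj z and F, weighted by the derivative of \<phi>\<close>
  define Q where "Q w = cnj (\<phi> w) * deriv \<phi> w - deriv p w" for w
  have Qlim: "(\<lambda>N. defect_upto N a w) \<longlonglongrightarrow> Q w" if w: "cmod w < 1" for w
    unfolding defect_upto_def Q_def p_def
    using sums[OF w] deriv_sums(1)[OF w]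
    by (intro tendsto_diff tendsto_mult tendsto_cnj proj_series_deriv(2)[OF s2 w]) (simp_all add: sums_def_le)
  have contQ: "continuous_on (ball 0 1) Q"
    unfolding Q_def using holomorphic_deriv[OF hol\<phi> open_ball] holomorphic_deriv[OF holp open_ball] hol\<phi>
    by (intro continuous_intros holomorphic_on_imp_continuous_on)
  have key: "(\<integral>\<^sup>+w. ennreal (indicator (ball 0 1) w * (cmod (Q w))\<^sup>2) \<partial>lborel) \<le> ennreal (pi / 2 * E\<^sup>2)"
  proof -
    have mN: "(\<lambda>w. ennreal (indicator (ball 0 1) w * (cmod (defect_upto N a w))\<^sup>2)) \<in> borel_measurable lborel" for N
      using borel_measurable_integrable[OF defect_upto_L2_bound(1)[of N a, unfolded set_integrable_def]] by simp
    have "(\<integral>\<^sup>+w. ennreal (indicator (ball 0 1) w * (cmod (Q w))\<^sup>2) \<partial>lborel)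
       = (\<integral>\<^sup>+w. liminf (\<lambda>N. ennreal (indicator (ball 0 1) w * (cmod (defect_upto N a w))\<^sup>2)) \<partial>lborel)"
    proof (intro nn_integral_cong)
      fix w :: complex
      have "(\<lambda>N. ennreal (indicator (ball 0 1) w * (cmod (defect_upto N a w))\<^sup>2)) \<longlonglongrightarrow> ennreal (indicator (ball 0 1) w * (cmod (Q w))\<^sup>2)"
      proof (cases "w \<in> ball 0 1")
        case True
        then have "(\<lambda>N. defect_upto N a w) \<longlonglongrightarrow> Q w" by (intro Qlim) simp
        then show ?thesis by (intro tendsto_ennrealI tendsto_intros)
      qed simp
      from lim_imp_Liminf[OF _ this] show "ennreal (indicator (ball 0 1) w * (cmod (Q w))\<^sup>2) = liminf (\<lambda>N. ennreal (indicator (ball 0 1) w * (cmod (defect_upto N a w))\<^sup>2))"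
        by simp
    qed
    also have "\<dots> \<le> liminf (\<lambda>N. \<integral>\<^sup>+w. ennreal (indicator (ball 0 1) w * (cmod (defect_upto N a w))\<^sup>2) \<partial>lborel)"
      by (rule nn_integral_liminf[OF mN])
    also have "\<dots> \<le> ennreal (pi / 2 * E\<^sup>2)"
    proof (rule Liminf_le, simp, intro always_eventually allI)
      fix N
      have "(\<Sum>n\<le>N. real n * (cmod (a n))\<^sup>2) \<le> E" unfolding E_def by (rule sum_le_suminf[OF s]) auto
      then have "(\<Sum>n\<le>N. real n * (cmod (a n))\<^sup>2)\<^sup>2 \<le> E\<^sup>2" by (intro power_mono sum_nonneg) auto
      then have le: "(LINT w:ball 0 1|lborel. (cmod (defect_upto N a w))\<^sup>2) \<le> pi / 2 * E\<^sup>2"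
        using order_trans[OF defect_upto_L2_bound(2)[of N a] mult_left_mono[of _ _ "pi/2"]] by simp
      have "(\<integral>\<^sup>+w. ennreal (indicator (ball 0 1) w * (cmod (defect_upto N a w))\<^sup>2) \<partial>lborel)
          = ennreal (LINT w:ball 0 1|lborel. (cmod (defect_upto N a w))\<^sup>2)"
        using nn_integral_eq_integral[OF defect_upto_L2_bound(1)[of N a, unfolded set_integrable_def]]
        unfolding set_lebesgue_integral_def by simp
      also have "\<dots> \<le> ennreal (pi / 2 * E\<^sup>2)" using le by (rule ennreal_leI)
      finally show "(\<integral>\<^sup>+w. ennreal (indicator (ball 0 1) w * (cmod (defect_upto N a w))\<^sup>2) \<partial>lborel) \<le> ennreal (pi / 2 * E\<^sup>2)" .
    qed
    finally show ?thesis .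
  qed
  have mQ: "(\<lambda>w. indicator (ball 0 1) w * (cmod (Q w))\<^sup>2) \<in> borel_measurable lborel"
    using set_borel_measurable_continuous_open[OF continuous_on_power[OF continuous_on_norm[OF contQ]] open_ball, of 2]
    by (simp add: set_borel_measurable_def)
  have iQ: "set_integrable lborel (ball 0 1) (\<lambda>w. (cmod (Q w))\<^sup>2)"
    unfolding set_integrable_def real_scaleR_def
    by (rule integrableI_nonneg[OF mQ]) (use le_less_trans[OF key] in auto)
  have vQ: "(LINT w:ball 0 1|lborel. (cmod (Q w))\<^sup>2) \<le> pi / 2 * E\<^sup>2"
  proof -
    have "ennreal (LINT w:ball 0 1|lborel. (cmod (Q w))\<^sup>2) \<le> ennreal (pi / 2 * E\<^sup>2)"
      using key nn_integral_eq_integral[OF iQ[unfolded set_integrable_def real_scaleR_def]]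
      unfolding set_lebesgue_integral_def by simp
    then show ?thesis by (subst (asm) ennreal_le_iff) auto
  qed
  have contF: "continuous_on \<Omega> F" using hol unfolding F_def by (rule holomorphic_on_imp_continuous_on)
  have cd: "continuous_on \<Omega> (\<lambda>z. (cmod (cnj z - F z))\<^sup>2)" by (intro continuous_intros contF)
  note cv = conformal_change_of_variables_real[OF open_ball hol\<phi> inj_disc, unfolded image_disc, OF cd]
  have Qe: "(cmod (deriv \<phi> w))\<^sup>2 * (cmod (cnj (\<phi> w) - F (\<phi> w)))\<^sup>2 = (cmod (Q w))\<^sup>2" if "cmod w < 1" for w
  proof -
    have "Q w = deriv \<phi> w * (cnj (\<phi> w) - F (\<phi> w))"
      unfolding Q_def F\<phi>[OF that, symmetric] by (simp add: algebra_simps)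
    then show ?thesis by (simp add: norm_mult power_mult_distrib)
  qed
  have ii: "set_integrable lborel (ball 0 1) (\<lambda>w. (cmod (deriv \<phi> w))\<^sup>2 * (cmod (cnj (\<phi> w) - F (\<phi> w)))\<^sup>2)"
    using iQ by (rule set_integrable_cong[THEN iffD1, rotated -1]) (auto simp: Qe)
  have vv: "(LINT w:ball 0 1|lborel. (cmod (deriv \<phi> w))\<^sup>2 * (cmod (cnj (\<phi> w) - F (\<phi> w)))\<^sup>2) = (LINT w:ball 0 1|lborel. (cmod (Q w))\<^sup>2)"
    by (rule set_lebesgue_integral_cong) (auto simp: Qe)
  have i\<Omega>: "set_integrable lborel \<Omega> (\<lambda>z. (cmod (cnj z - F z))\<^sup>2)" using cv(1) ii by blast
  have v\<Omega>: "(LINT z:\<Omega>|lborel. (cmod (cnj z - F z))\<^sup>2) \<le> pi / 2 * E\<^sup>2" using cv(2) vv vQ by simp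
  have "F \<in> bergman_space \<Omega>"
    unfolding bergman_space_def
  proof (intro CollectI conjI)
    show "F holomorphic_on \<Omega>" using hol by (simp add: F_def)
    have "continuous_on \<Omega> (\<lambda>z. cnj z - F z)" by (intro continuous_intros contF)
    from cnj_minus_square_integrable[OF op bd this i\<Omega>]
    show "set_integrable lborel \<Omega> (\<lambda>z. (cmod (F z))\<^sup>2)" by simp
  qed
  moreover have "L2_norm_on \<Omega> (\<lambda>z. cnj z - F z) \<le> measure lborel \<Omega> / sqrt (2 * pi)"
  proof -
    have "0 \<le> E" unfolding E_def by (rule suminf_nonneg[OF s]) auto
    then have "(pi * E)\<^sup>2 \<le> (measure lborel \<Omega>)\<^sup>2" using area_bound(2) unfolding E_def[symmetric] by (intro power_mono) auto
    then have "pi / 2 * E\<^sup>2 \<le> (measure lborel \<Omega>)\<^sup>2 / (2 * pi)" by (simp add: power2_eq_square field_simps)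
    then have "(LINT z:\<Omega>|lborel. (cmod (cnj z - F z))\<^sup>2) \<le> (measure lborel \<Omega>)\<^sup>2 / (2 * pi)" using v\<Omega> by simp
    from real_sqrt_le_mono[OF this] show ?thesis unfolding L2_norm_on_def by (simp add: real_sqrt_divide)
  qed
  ultimately show ?thesis by blast
qed

end

section \<open>The two bounds\<close>

theorem theorem6:
  fixes \<Omega> :: "complex set"
  assumes "open \<Omega>" and "connected \<Omega>" and "\<Omega> \<noteq> {}"
    and "bounded \<Omega>" and "simply_connected \<Omega>"
    and "piecewise_smooth_boundary \<Omega>"
  shows "sqrt (torsional_rigidity \<Omega>) \<le> bergman_dist \<Omega> \<and>
         bergman_dist \<Omega> \<le> measure lborel \<Omega> / sqrt (2 * pi)"
proof -
  have "\<Omega> \<noteq> UNIV" using assms(4) not_bounded_UNIV by blast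
  then obtain \<psi> \<phi> where m: "\<psi> holomorphic_on \<Omega>" "\<phi> holomorphic_on ball 0 1"
    "\<forall>z\<in>\<Omega>. \<psi> z \<in> ball 0 1 \<and> \<phi> (\<psi> z) = z" "\<forall>w\<in>ball 0 1. \<phi> w \<in> \<Omega> \<and> \<psi> (\<phi> w) = w"
    using Riemann_mapping_theorem[of \<Omega>] assms(1,3,5) by blast
  interpret disc_parametrisation \<Omega> \<phi> \<psi> "\<lambda>n. (deriv ^^ n) \<phi> 0 / fact n"
    using m assms(1,4) holomorphic_power_series[OF m(2)] by unfold_locales auto
  obtain F where F: "F \<in> bergman_space \<Omega>" "L2_norm_on \<Omega> (\<lambda>z. cnj z - F z) \<le> measure lborel \<Omega> / sqrt (2 * pi)"
    using bergman_competitor by blast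
  have L0: "0 \<le> L2_norm_on \<Omega> g" for g
    unfolding L2_norm_on_def set_lebesgue_integral_def by (intro real_sqrt_ge_zero integral_nonneg_AE AE_I2) auto
  have "bdd_below ((\<lambda>f. L2_norm_on \<Omega> (\<lambda>z. cnj z - f z)) ` bergman_space \<Omega>)"
    using L0 by (intro bdd_belowI[of _ 0]) auto
  then have upper: "bergman_dist \<Omega> \<le> measure lborel \<Omega> / sqrt (2 * pi)"
    unfolding bergman_dist_def using F by (intro cINF_lower2)
  define u where "u = stress_function \<Omega>"
  have st: "is_stress_function \<Omega> u"
    unfolding u_def stress_function_def using exists_stress_function[OF area_bound(1)] by (rule someI_ex)
  have rho: "sqrt (torsional_rigidity \<Omega>) = 2 * \<bar>LINT z:\<Omega>|lborel. u z\<bar> / L2_norm_on \<Omega> (gradient u)"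
    unfolding torsional_rigidity_def Let_def u_def[symmetric] using L0 by (simp add: abs_mult)
  have "sqrt (torsional_rigidity \<Omega>) \<le> L2_norm_on \<Omega> (\<lambda>z. cnj z - f z)" if f: "f \<in> bergman_space \<Omega>" for f
  proof (cases "set_integrable lborel \<Omega> (\<lambda>z. (cmod (gradient u z))\<^sup>2) \<and> L2_norm_on \<Omega> (gradient u) \<noteq> 0")
    case True
    then have "2 * \<bar>LINT z:\<Omega>|lborel. u z\<bar> \<le> L2_norm_on \<Omega> (\<lambda>z. cnj z - f z) * L2_norm_on \<Omega> (gradient u)"
      by (intro torsion_pairing_bound op bd st f) auto
    then show ?thesis unfolding rho using True L0[of "gradient u"] by (simp add: divide_le_eq)
  next
    case False
    \<comment> \<open>in this case the quotient defining the torsional rigidity is 0 by convention\<close>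
    then have "L2_norm_on \<Omega> (gradient u) = 0"
      by (auto simp: L2_norm_on_def set_integrable_def set_lebesgue_integral_def not_integrable_integral_eq)
    then show ?thesis unfolding rho using L0 by simp
  qed
  then have "sqrt (torsional_rigidity \<Omega>) \<le> bergman_dist \<Omega>"
    unfolding bergman_dist_def using F(1) by (intro cINF_greatest) auto
  with upper show ?thesis by blast
qed

end
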